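(* (Adequacy of encoding of emptiness.) For every positive type name $t$ of the object signature, there is a bijection between the circular derivations of $t\ \mathsf{empty}$ and the canonical forms of the CoLF type $\mathtt{empty}\ \ulcorner t\urcorner$.
   Context: Positive equirecursive types: $\tau^+::=t_1^+\otimes t_2^+\mid\mathbf 1\mid t_1^+\oplus t_2^+\mid\mathbf 0$ over type names $t^+$ defined by an object signature of definitions $t^+=\tau^+$. The judgment $t\ \mathsf{empty}$ is defined coinductively (derivations may be circular/infinite) by: $\mathbf 0\ \mathsf{empty}$; if $t=t_1\oplus t_2$ in the signature and $t_1\ \mathsf{empty}$ and $t_2\ \mathsf{empty}$ then $t\ \mathsf{empty}$; if $t=t_1\otimes t_2$ and $t_1\ \mathsf{empty}$ then $t\ \mathsf{empty}$; if $t=t_1\otimes t_2$ and $t_2\ \mathsf{empty}$ then $t\ \mathsf{empty}$. CoLF encoding: postp : cotype; times : postp -> postp -> postp; one : postp; plus : postp -> postp -> postp; zero : postp; empty : postp -> cotype; zero_emp : empty zero; plus_emp : empty T1 -> empty T2 -> empty (plus T1 T2); times_emp_1 : empty T1 -> empty (times T1 T2); times_emp_2 : empty T2 -> empty (times T1 T2). Each object definition $t=\tau$ is encoded as a CoLF recursion constant $\mathtt t:\mathtt{postp}=\ulcorner\tau\urcorner$ (with times/one/plus/zero for $\otimes,\mathbf 1,\oplus,\mathbf 0$), and cycles in derivations as CoLF recursion constants; CoLF terms are identified up to their infinite unfoldings. *)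

theory Defs
  imports Main
begin

section \<open>The fragment of CoLF in which every type family is a cotype\<close>

text \<open>
  Terms are in canonical (beta-normal, eta-long) spine form, with de Bruijn indices. Binders and
  spine entries come in two modes: ordinary ones, and prepattern ones, where the argument of a
  prepattern product can only be a prepattern variable. Recursion constants have prepattern
  product types, so they are only ever applied to variables.

  CoLF additionally has inductive families (of kind \<open>type\<close>) and a validity condition on the
  infinite traces that pass through constructors of such families. As there are no such families
  here, the validity condition is vacuous, and \<open>cotype\<close> is the only base kind.
\<close>

datatype mode = Ord | Pre

datatype 'x arg = Arg 'x | PArg nat

datatype ('c, 'r) head = Var nat | Con 'c | Rec 'r

datatype ('c, 'r) tm = Lam mode "('c, 'r) tm" | App "('c, 'r) head" "('c, 'r) tm arg list"

datatype ('a, 'c, 'r) ty =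
  Atom 'a "('c, 'r) tm arg list"
| Pi mode "('a, 'c, 'r) ty" "('a, 'c, 'r) ty"

datatype ('a, 'c, 'r) kd = Cotype | KPi mode "('a, 'c, 'r) ty" "('a, 'c, 'r) kd"

datatype ('a, 'c, 'r) decl =
  is_FamDecl: FamDecl 'a "('a, 'c, 'r) kd"
| is_ConDecl: ConDecl 'c "('a, 'c, 'r) ty"
| is_RecDecl: RecDecl 'r "('a, 'c, 'r) ty" "('c, 'r) tm"

type_synonym ('a, 'c, 'r) lfsig = "('a, 'c, 'r) decl list"

type_synonym ('a, 'c, 'r) ctxt = "(mode \<times> ('a, 'c, 'r) ty) list"


subsection \<open>Renaming\<close>

fun up :: "(nat \<Rightarrow> nat) \<Rightarrow> nat \<Rightarrow> nat" where
  "up f 0 = 0"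
| "up f (Suc i) = Suc (f i)"

fun ren_head :: "(nat \<Rightarrow> nat) \<Rightarrow> ('c, 'r) head \<Rightarrow> ('c, 'r) head" where
  "ren_head f (Var i) = Var (f i)"
| "ren_head f (Con c) = Con c"
| "ren_head f (Rec r) = Rec r"

fun map_var_arg :: "(nat \<Rightarrow> nat) \<Rightarrow> ('x \<Rightarrow> 'y) \<Rightarrow> 'x arg \<Rightarrow> 'y arg" where
  "map_var_arg f g (Arg M) = Arg (g M)"
| "map_var_arg f g (PArg i) = PArg (f i)"

lemma map_var_arg_cong [fundef_cong]:
  assumes "f = f'" "a = a'" "\<And>x. x \<in> set_arg a' \<Longrightarrow> g x = g' x"
  shows "map_var_arg f g a = map_var_arg f' g' a'"
  using assms by (cases a') auto

lemma size_set_arg: "x \<in> set_arg a \<Longrightarrow> g x < size_arg g a"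
  by (cases a) auto

function (sequential) ren :: "(nat \<Rightarrow> nat) \<Rightarrow> ('c, 'r) tm \<Rightarrow> ('c, 'r) tm" where
  "ren f (Lam m M) = Lam m (ren (up f) M)"
| "ren f (App h S) = App (ren_head f h) (map (map_var_arg f (ren f)) S)"
  by pat_completeness auto
termination
proof (relation "measure (\<lambda>(f, M). size M)", goal_cases)
  case (3 f h S a M)
  then have "size M < size_arg size a" "size_arg size a \<le> size_list (size_arg size) S"
    by (auto intro: size_set_arg size_list_estimation')
  then show ?case by simp
qed auto

abbreviation ren_arg :: "(nat \<Rightarrow> nat) \<Rightarrow> ('c, 'r) tm arg \<Rightarrow> ('c, 'r) tm arg" where
  "ren_arg f \<equiv> map_var_arg f (ren f)"

fun ren_ty :: "(nat \<Rightarrow> nat) \<Rightarrow> ('a, 'c, 'r) ty \<Rightarrow> ('a, 'c, 'r) ty" where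
  "ren_ty f (Atom a S) = Atom a (map (ren_arg f) S)"
| "ren_ty f (Pi m A B) = Pi m (ren_ty f A) (ren_ty (up f) B)"

fun ren_kd :: "(nat \<Rightarrow> nat) \<Rightarrow> ('a, 'c, 'r) kd \<Rightarrow> ('a, 'c, 'r) kd" where
  "ren_kd f Cotype = Cotype"
| "ren_kd f (KPi m A K) = KPi m (ren_ty f A) (ren_kd (up f) K)"

text \<open>Replaces variable 0 by variable \<open>x\<close> and lowers all other indices.\<close>

fun inst :: "nat \<Rightarrow> nat \<Rightarrow> nat" where
  "inst x 0 = x"
| "inst x (Suc i) = i"


subsection \<open>Hereditary substitution\<close>

text \<open>
  \<open>hsub N k M M'\<close>: substituting \<open>N\<close> for the ordinary variable \<open>k\<close> in \<open>M\<close> yields \<open>M'\<close>;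
  \<open>hred N S R\<close>: applying \<open>N\<close> to the spine \<open>S\<close> yields \<open>R\<close>. Being inductively defined relations,
  they need no index by simple types to ensure termination.
\<close>

inductive hsub :: "('c, 'r) tm \<Rightarrow> nat \<Rightarrow> ('c, 'r) tm \<Rightarrow> ('c, 'r) tm \<Rightarrow> bool"
  and hsubs :: "('c, 'r) tm \<Rightarrow> nat \<Rightarrow> ('c, 'r) tm arg list \<Rightarrow> ('c, 'r) tm arg list \<Rightarrow> bool"
  and hred :: "('c, 'r) tm \<Rightarrow> ('c, 'r) tm arg list \<Rightarrow> ('c, 'r) tm \<Rightarrow> bool"
where
  hsub_Lam: "hsub (ren Suc N) (Suc k) M M' \<Longrightarrow> hsub N k (Lam m M) (Lam m M')"
| hsub_eq: "hsubs N k S S' \<Longrightarrow> hred N S' R \<Longrightarrow> hsub N k (App (Var k) S) R"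
| hsub_less: "i < k \<Longrightarrow> hsubs N k S S' \<Longrightarrow> hsub N k (App (Var i) S) (App (Var i) S')"
| hsub_greater: "k < i \<Longrightarrow> hsubs N k S S' \<Longrightarrow> hsub N k (App (Var i) S) (App (Var (i - 1)) S')"
| hsub_Con: "hsubs N k S S' \<Longrightarrow> hsub N k (App (Con c) S) (App (Con c) S')"
| hsub_Rec: "hsubs N k S S' \<Longrightarrow> hsub N k (App (Rec r) S) (App (Rec r) S')"
| hsubs_Nil: "hsubs N k [] []"
| hsubs_Arg: "hsub N k M M' \<Longrightarrow> hsubs N k S S' \<Longrightarrow> hsubs N k (Arg M # S) (Arg M' # S')"
| hsubs_PArg_less: "i < k \<Longrightarrow> hsubs N k S S' \<Longrightarrow> hsubs N k (PArg i # S) (PArg i # S')"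
| hsubs_PArg_greater: "k < i \<Longrightarrow> hsubs N k S S' \<Longrightarrow> hsubs N k (PArg i # S) (PArg (i - 1) # S')"
| hred_Nil: "hred (App h S) [] (App h S)"
| hred_Arg: "hsub N 0 M M' \<Longrightarrow> hred M' S R \<Longrightarrow> hred (Lam Ord M) (Arg N # S) R"
| hred_PArg: "hred (ren (inst x) M) S R \<Longrightarrow> hred (Lam Pre M) (PArg x # S) R"

inductive hsub_ty :: "('c, 'r) tm \<Rightarrow> nat \<Rightarrow> ('a, 'c, 'r) ty \<Rightarrow> ('a, 'c, 'r) ty \<Rightarrow> bool" where
  "hsubs N k S S' \<Longrightarrow> hsub_ty N k (Atom a S) (Atom a S')"
| "hsub_ty N k A A' \<Longrightarrow> hsub_ty (ren Suc N) (Suc k) B B' \<Longrightarrow> hsub_ty N k (Pi m A B) (Pi m A' B')"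

inductive hsub_kd :: "('c, 'r) tm \<Rightarrow> nat \<Rightarrow> ('a, 'c, 'r) kd \<Rightarrow> ('a, 'c, 'r) kd \<Rightarrow> bool" where
  "hsub_kd N k Cotype Cotype"
| "hsub_ty N k A A' \<Longrightarrow> hsub_kd (ren Suc N) (Suc k) K K' \<Longrightarrow>
    hsub_kd N k (KPi m A K) (KPi m A' K')"


subsection \<open>Infinite unfolding and definitional equality\<close>

text \<open>
  Unfolding all recursion constants turns a term into a possibly infinite Boehm tree. Terms are
  equal if they unfold to the same tree.
\<close>

datatype 'c bhead = BVar nat | BCon 'c

codatatype 'c btree = BLam mode "'c btree" | BApp "'c bhead" "'c btree arg list"

inductive hnf ::
  "('a, 'c, 'r) lfsig \<Rightarrow> ('c, 'r) tm \<Rightarrow> 'c bhead \<Rightarrow> ('c, 'r) tm arg list \<Rightarrow> bool" for \<Sigma> where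
  hnf_Var: "hnf \<Sigma> (App (Var i) S) (BVar i) S"
| hnf_Con: "hnf \<Sigma> (App (Con c) S) (BCon c) S"
| hnf_Rec: "RecDecl r A N \<in> set \<Sigma> \<Longrightarrow> hred N S R \<Longrightarrow> hnf \<Sigma> R h S' \<Longrightarrow> hnf \<Sigma> (App (Rec r) S) h S'"

coinductive unfolds :: "('a, 'c, 'r) lfsig \<Rightarrow> ('c, 'r) tm \<Rightarrow> 'c btree \<Rightarrow> bool" for \<Sigma> where
  unfolds_Lam: "unfolds \<Sigma> M T \<Longrightarrow> unfolds \<Sigma> (Lam m M) (BLam m T)"
| unfolds_App: "hnf \<Sigma> R h S \<Longrightarrow> list_all2 (rel_arg (unfolds \<Sigma>)) S Ts \<Longrightarrow> unfolds \<Sigma> R (BApp h Ts)"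
  monos list.rel_mono_strong arg.rel_mono_strong

definition tm_eq :: "('a, 'c, 'r) lfsig \<Rightarrow> ('c, 'r) tm \<Rightarrow> ('c, 'r) tm \<Rightarrow> bool" where
  "tm_eq \<Sigma> M N \<longleftrightarrow> (\<exists>T. unfolds \<Sigma> M T \<and> unfolds \<Sigma> N T)"

inductive ty_eq :: "('a, 'c, 'r) lfsig \<Rightarrow> ('a, 'c, 'r) ty \<Rightarrow> ('a, 'c, 'r) ty \<Rightarrow> bool" for \<Sigma> where
  "list_all2 (rel_arg (tm_eq \<Sigma>)) S S' \<Longrightarrow> ty_eq \<Sigma> (Atom a S) (Atom a S')"
| "ty_eq \<Sigma> A A' \<Longrightarrow> ty_eq \<Sigma> B B' \<Longrightarrow> ty_eq \<Sigma> (Pi m A B) (Pi m A' B')"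


subsection \<open>Typing\<close>

definition lookup :: "('a, 'c, 'r) ctxt \<Rightarrow> nat \<Rightarrow> mode \<Rightarrow> ('a, 'c, 'r) ty \<Rightarrow> bool" where
  "lookup \<Gamma> i m A \<longleftrightarrow>
     i < length \<Gamma> \<and> m = fst (\<Gamma> ! i) \<and> A = ren_ty (\<lambda>j. j + Suc i) (snd (\<Gamma> ! i))"

text \<open>
  \<open>chk \<Sigma> \<Gamma> M A\<close>: \<open>M\<close> checks against \<open>A\<close>; \<open>syn \<Sigma> \<Gamma> R P\<close>: the neutral term \<open>R\<close> synthesizes the atomic
  type \<open>P\<close>; \<open>spn \<Sigma> \<Gamma> S A P\<close>: applying a head of type \<open>A\<close> to the spine \<open>S\<close> gives type \<open>P\<close>.
\<close>

inductive chk :: "('a, 'c, 'r) lfsig \<Rightarrow> ('a, 'c, 'r) ctxt \<Rightarrow> ('c, 'r) tm \<Rightarrow> ('a, 'c, 'r) ty \<Rightarrow> bool"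
  and syn :: "('a, 'c, 'r) lfsig \<Rightarrow> ('a, 'c, 'r) ctxt \<Rightarrow> ('c, 'r) tm \<Rightarrow> ('a, 'c, 'r) ty \<Rightarrow> bool"
  and spn :: "('a, 'c, 'r) lfsig \<Rightarrow> ('a, 'c, 'r) ctxt \<Rightarrow> ('c, 'r) tm arg list \<Rightarrow>
    ('a, 'c, 'r) ty \<Rightarrow> ('a, 'c, 'r) ty \<Rightarrow> bool"
  for \<Sigma>
where
  chk_Lam: "chk \<Sigma> ((m, A) # \<Gamma>) M B \<Longrightarrow> chk \<Sigma> \<Gamma> (Lam m M) (Pi m A B)"
| chk_App: "syn \<Sigma> \<Gamma> (App h S) P' \<Longrightarrow> ty_eq \<Sigma> P' (Atom a S') \<Longrightarrow> chk \<Sigma> \<Gamma> (App h S) (Atom a S')"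
| syn_Var: "lookup \<Gamma> i m A \<Longrightarrow> spn \<Sigma> \<Gamma> S A P \<Longrightarrow> syn \<Sigma> \<Gamma> (App (Var i) S) P"
| syn_Con: "ConDecl c A \<in> set \<Sigma> \<Longrightarrow> spn \<Sigma> \<Gamma> S A P \<Longrightarrow> syn \<Sigma> \<Gamma> (App (Con c) S) P"
| syn_Rec: "RecDecl r A N \<in> set \<Sigma> \<Longrightarrow> spn \<Sigma> \<Gamma> S A P \<Longrightarrow> syn \<Sigma> \<Gamma> (App (Rec r) S) P"
| spn_Nil: "spn \<Sigma> \<Gamma> [] (Atom a S) (Atom a S)"
| spn_Arg: "chk \<Sigma> \<Gamma> M A \<Longrightarrow> hsub_ty M 0 B B' \<Longrightarrow> spn \<Sigma> \<Gamma> S B' P \<Longrightarrow>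
    spn \<Sigma> \<Gamma> (Arg M # S) (Pi Ord A B) P"
| spn_PArg: "lookup \<Gamma> x Pre A' \<Longrightarrow> ty_eq \<Sigma> A' A \<Longrightarrow> spn \<Sigma> \<Gamma> S (ren_ty (inst x) B) P \<Longrightarrow>
    spn \<Sigma> \<Gamma> (PArg x # S) (Pi Pre A B) P"

inductive kspn :: "('a, 'c, 'r) lfsig \<Rightarrow> ('a, 'c, 'r) ctxt \<Rightarrow> ('c, 'r) tm arg list \<Rightarrow>
    ('a, 'c, 'r) kd \<Rightarrow> bool"
  for \<Sigma> \<Gamma>
where
  "kspn \<Sigma> \<Gamma> [] Cotype"
| "chk \<Sigma> \<Gamma> M A \<Longrightarrow> hsub_kd M 0 K K' \<Longrightarrow> kspn \<Sigma> \<Gamma> S K' \<Longrightarrow> kspn \<Sigma> \<Gamma> (Arg M # S) (KPi Ord A K)"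
| "lookup \<Gamma> x Pre A' \<Longrightarrow> ty_eq \<Sigma> A' A \<Longrightarrow> kspn \<Sigma> \<Gamma> S (ren_kd (inst x) K) \<Longrightarrow>
    kspn \<Sigma> \<Gamma> (PArg x # S) (KPi Pre A K)"

inductive wf_ty :: "('a, 'c, 'r) lfsig \<Rightarrow> ('a, 'c, 'r) ctxt \<Rightarrow> ('a, 'c, 'r) ty \<Rightarrow> bool" for \<Sigma> where
  "FamDecl a K \<in> set \<Sigma> \<Longrightarrow> kspn \<Sigma> \<Gamma> S K \<Longrightarrow> wf_ty \<Sigma> \<Gamma> (Atom a S)"
| "wf_ty \<Sigma> \<Gamma> A \<Longrightarrow> wf_ty \<Sigma> ((m, A) # \<Gamma>) B \<Longrightarrow> wf_ty \<Sigma> \<Gamma> (Pi m A B)"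

inductive wf_kd :: "('a, 'c, 'r) lfsig \<Rightarrow> ('a, 'c, 'r) ctxt \<Rightarrow> ('a, 'c, 'r) kd \<Rightarrow> bool" for \<Sigma> where
  "wf_kd \<Sigma> \<Gamma> Cotype"
| "wf_ty \<Sigma> \<Gamma> A \<Longrightarrow> wf_kd \<Sigma> ((m, A) # \<Gamma>) K \<Longrightarrow> wf_kd \<Sigma> \<Gamma> (KPi m A K)"

fun prepattern :: "('a, 'c, 'r) ty \<Rightarrow> bool" where
  "prepattern (Atom a S) = True"
| "prepattern (Pi m A B) = (m = Pre \<and> prepattern B)"

fun contractive :: "('c, 'r) tm \<Rightarrow> bool" where
  "contractive (Lam m M) = contractive M"
| "contractive (App h S) = (\<forall>r. h \<noteq> Rec r)"

text \<open>
  Declarations are checked against the whole signature, since recursion constants may be mutually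
  recursive.
\<close>

fun wf_decl :: "('a, 'c, 'r) lfsig \<Rightarrow> ('a, 'c, 'r) decl \<Rightarrow> bool" where
  "wf_decl \<Sigma> (FamDecl a K) = wf_kd \<Sigma> [] K"
| "wf_decl \<Sigma> (ConDecl c A) = wf_ty \<Sigma> [] A"
| "wf_decl \<Sigma> (RecDecl r A M) = (wf_ty \<Sigma> [] A \<and> prepattern A \<and> chk \<Sigma> [] M A \<and> contractive M)"

datatype ('a, 'c, 'r) sname = FamName 'a | ConName 'c | RecName 'r

fun decl_name :: "('a, 'c, 'r) decl \<Rightarrow> ('a, 'c, 'r) sname" where
  "decl_name (FamDecl a K) = FamName a"
| "decl_name (ConDecl c A) = ConName c"
| "decl_name (RecDecl r A M) = RecName r"

definition wf_sig :: "('a, 'c, 'r) lfsig \<Rightarrow> bool" where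
  "wf_sig \<Sigma> \<longleftrightarrow> distinct (map decl_name \<Sigma>) \<and> (\<forall>d \<in> set \<Sigma>. wf_decl \<Sigma> d)"

text \<open>
  A canonical form of \<open>A\<close> may involve further recursion constants \<open>\<Delta>\<close> for its own cycles. Taking
  the infinite unfoldings identifies terms that differ only in their use of recursion constants.
\<close>

definition canonical_forms :: "('a, 'c, 'r) lfsig \<Rightarrow> ('a, 'c, 'r) ty \<Rightarrow> 'c btree set" where
  "canonical_forms \<Sigma> A = {T. \<exists>\<Delta> M. (\<forall>d \<in> set \<Delta>. is_RecDecl d) \<and> wf_sig (\<Sigma> @ \<Delta>) \<and>
     chk (\<Sigma> @ \<Delta>) [] M A \<and> unfolds (\<Sigma> @ \<Delta>) M T}"


section \<open>Positive equirecursive types and emptiness\<close>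

datatype 't ptyp = TimesT 't 't | OneT | PlusT 't 't | ZeroT

type_synonym 't osig = "('t \<times> 't ptyp) list"

definition wf_osig :: "'t osig \<Rightarrow> bool" where
  "wf_osig \<Omega> \<longleftrightarrow> distinct (map fst \<Omega>) \<and>
     (\<forall>(t, \<tau>) \<in> set \<Omega>. set_ptyp \<tau> \<subseteq> fst ` set \<Omega>)"

text \<open>
  Every node of a derivation carries the type name \<open>t\<close> of its conclusion \<open>t empty\<close>.
\<close>

codatatype 't deriv =
  ZeroEmp 't
| PlusEmp 't "'t deriv" "'t deriv"
| TimesEmp1 't "'t deriv"
| TimesEmp2 't "'t deriv"

coinductive derives :: "'t osig \<Rightarrow> 't deriv \<Rightarrow> 't \<Rightarrow> bool" for \<Omega> where
  "(t, ZeroT) \<in> set \<Omega> \<Longrightarrow> derives \<Omega> (ZeroEmp t) t"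
| "(t, PlusT t1 t2) \<in> set \<Omega> \<Longrightarrow> derives \<Omega> d1 t1 \<Longrightarrow> derives \<Omega> d2 t2 \<Longrightarrow>
    derives \<Omega> (PlusEmp t d1 d2) t"
| "(t, TimesT t1 t2) \<in> set \<Omega> \<Longrightarrow> derives \<Omega> d t1 \<Longrightarrow> derives \<Omega> (TimesEmp1 t d) t"
| "(t, TimesT t1 t2) \<in> set \<Omega> \<Longrightarrow> derives \<Omega> d t2 \<Longrightarrow> derives \<Omega> (TimesEmp2 t d) t"

inductive_set subderivs :: "'t deriv \<Rightarrow> 't deriv set" for d where
  "d \<in> subderivs d"
| "PlusEmp t d1 d2 \<in> subderivs d \<Longrightarrow> d1 \<in> subderivs d"
| "PlusEmp t d1 d2 \<in> subderivs d \<Longrightarrow> d2 \<in> subderivs d"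
| "TimesEmp1 t d' \<in> subderivs d \<Longrightarrow> d' \<in> subderivs d"
| "TimesEmp2 t d' \<in> subderivs d \<Longrightarrow> d' \<in> subderivs d"

text \<open>
  A circular derivation, i.e. a finite derivation with back edges, denotes a possibly infinite
  derivation tree with finitely many distinct subtrees, and every such tree arises in this way.
  As on the side of CoLF, presentations with the same unfolding are identified.
\<close>

definition circular_derivations :: "'t osig \<Rightarrow> 't \<Rightarrow> 't deriv set" where
  "circular_derivations \<Omega> t = {d. derives \<Omega> d t \<and> finite (subderivs d)}"


section \<open>The encoding\<close>

datatype fam = postp | empty

datatype con = times | one | plus | zero | zero_emp | plus_emp | times_emp_1 | times_emp_2

text \<open>
  \<open>TName t\<close> is the recursion constant for the type name \<open>t\<close>; the names \<open>Aux n\<close> remain available for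
  further recursion constants.
\<close>

datatype 't rname = TName 't | Aux nat

type_synonym 't etm = "(con, 't rname) tm"
type_synonym 't ety = "(fam, con, 't rname) ty"

abbreviation capp :: "con \<Rightarrow> 't etm list \<Rightarrow> 't etm" where
  "capp c Ms \<equiv> App (Con c) (map Arg Ms)"

abbreviation postp_ty :: "'t ety" where
  "postp_ty \<equiv> Atom postp []"

abbreviation empty_ty :: "'t etm \<Rightarrow> 't ety" where
  "empty_ty M \<equiv> Atom empty [Arg M]"

abbreviation dbv :: "nat \<Rightarrow> 't etm" where
  "dbv i \<equiv> App (Var i) []"

abbreviation arrow :: "'t ety \<Rightarrow> 't ety \<Rightarrow> 't ety" (infixr \<open>\<rightarrow>\<^sub>o\<close> 60) where
  "A \<rightarrow>\<^sub>o B \<equiv> Pi Ord A (ren_ty Suc B)"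

text \<open>The implicit arguments \<open>T1\<close> and \<open>T2\<close>, here \<open>dbv 1\<close> and \<open>dbv 0\<close>, are made explicit.\<close>

abbreviation forall_T1_T2 :: "'t ety \<Rightarrow> 't ety" where
  "forall_T1_T2 A \<equiv> Pi Ord postp_ty (Pi Ord postp_ty A)"

definition base_sig :: "(fam, con, 't rname) lfsig" where
  "base_sig = [
     FamDecl postp Cotype,
     ConDecl times (postp_ty \<rightarrow>\<^sub>o postp_ty \<rightarrow>\<^sub>o postp_ty),
     ConDecl one postp_ty,
     ConDecl plus (postp_ty \<rightarrow>\<^sub>o postp_ty \<rightarrow>\<^sub>o postp_ty),
     ConDecl zero postp_ty,
     FamDecl empty (KPi Ord postp_ty Cotype),
     ConDecl zero_emp (empty_ty (capp zero [])),
     ConDecl plus_emp (forall_T1_T2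
       (empty_ty (dbv 1) \<rightarrow>\<^sub>o empty_ty (dbv 0) \<rightarrow>\<^sub>o empty_ty (capp plus [dbv 1, dbv 0]))),
     ConDecl times_emp_1 (forall_T1_T2
       (empty_ty (dbv 1) \<rightarrow>\<^sub>o empty_ty (capp times [dbv 1, dbv 0]))),
     ConDecl times_emp_2 (forall_T1_T2
       (empty_ty (dbv 0) \<rightarrow>\<^sub>o empty_ty (capp times [dbv 1, dbv 0])))]"

definition enc_name :: "'t \<Rightarrow> 't etm" where
  "enc_name t = App (Rec (TName t)) []"

fun enc_ptyp :: "'t ptyp \<Rightarrow> 't etm" where
  "enc_ptyp (TimesT t1 t2) = capp times [enc_name t1, enc_name t2]"
| "enc_ptyp OneT = capp one []"
| "enc_ptyp (PlusT t1 t2) = capp plus [enc_name t1, enc_name t2]"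
| "enc_ptyp ZeroT = capp zero []"

definition enc_sig :: "'t osig \<Rightarrow> (fam, con, 't rname) lfsig" where
  "enc_sig \<Omega> = base_sig @ map (\<lambda>(t, \<tau>). RecDecl (TName t) postp_ty (enc_ptyp \<tau>)) \<Omega>"

end

theory Submission
  imports Defs
begin

text \<open>
  The bijection sends a derivation to the Boehm tree of the same shape which, at every node,
  additionally contains the trees of the component type names as implicit arguments. It is injective
  because each type name has a unique definition. The tree of a derivation with finitely many
  subderivations is the unfolding of a term that has one recursion constant per subderivation.
  Conversely, a closed canonical term of type \<open>empty \<ulcorner>t\<urcorner>\<close> has only closed atomic arguments, so it is
  explored without ever applying a recursion constant; every term met on the way is a subterm of the
  initial term or of the body of a recursion constant. Paired with the type names, these finitely
  many terms are the states of a coalgebra whose unfolding is a circular derivation.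
\<close>


section \<open>Hereditary substitution\<close>

inductive_simps hsub_Lam_iff: "hsub N k (Lam m M) R"
inductive_simps hsub_Var_iff: "hsub N k (App (Var i) S) R"
inductive_simps hsub_Con_iff: "hsub N k (App (Con c) S) R"
inductive_simps hsub_Rec_iff: "hsub N k (App (Rec r) S) R"
inductive_simps hsubs_Nil_iff: "hsubs N k [] R"
inductive_simps hsubs_Arg_iff: "hsubs N k (Arg M # S) R"
inductive_simps hsubs_PArg_iff: "hsubs N k (PArg i # S) R"
inductive_simps hred_App_iff: "hred (App h S) S' R"
inductive_simps hred_Lam_iff: "hred (Lam m M) S' R"
inductive_simps hsub_ty_Atom_iff: "hsub_ty N k (Atom a S) A"
inductive_simps hsub_ty_Pi_iff: "hsub_ty N k (Pi m A B) C"
inductive_simps hsub_kd_Cotype_iff: "hsub_kd N k Cotype K"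

lemmas hsub_iffs = hsub_Lam_iff hsub_Var_iff hsub_Con_iff hsub_Rec_iff
  hsubs_Nil_iff hsubs_Arg_iff hsubs_PArg_iff hred_App_iff hred_Lam_iff

lemma hsub_hred_functional:
  shows "hsub N k M M1 \<Longrightarrow> hsub N k M M2 \<Longrightarrow> M2 = M1"
    and "hsubs N k S S1 \<Longrightarrow> hsubs N k S S2 \<Longrightarrow> S2 = S1"
    and "hred N S R1 \<Longrightarrow> hred N S R2 \<Longrightarrow> R2 = R1"
  by (induction arbitrary: M2 and S2 and R2 rule: hsub_hsubs_hred.inducts)
    (unfold hsub_iffs, fastforce+)


section \<open>Definitional equality\<close>

inductive_simps hnf_Lam_iff: "hnf \<Sigma> (Lam m M) h S"
inductive_simps hnf_Var_iff: "hnf \<Sigma> (App (Var i) S) h S'"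
inductive_simps hnf_Con_iff: "hnf \<Sigma> (App (Con c) S) h S'"
inductive_simps hnf_Rec_iff: "hnf \<Sigma> (App (Rec r) S) h S'"
inductive_simps unfolds_Lam_iff: "unfolds \<Sigma> (Lam m M) T"
inductive_simps unfolds_App_iff: "unfolds \<Sigma> (App h S) T"
inductive_simps ty_eq_Atom_iff: "ty_eq \<Sigma> (Atom a S) B"
inductive_simps ty_eq_Atom_right_iff: "ty_eq \<Sigma> A (Atom a S)"
inductive_simps ty_eq_Pi_iff: "ty_eq \<Sigma> (Pi m A B) C"

lemma inj_decl_name_if_wf_sig: "wf_sig \<Sigma> \<Longrightarrow> inj_on decl_name (set \<Sigma>)"
  by (simp add: wf_sig_def distinct_map)

lemma RecDecl_unique:
  assumes "inj_on decl_name (set \<Sigma>)" "RecDecl r A N \<in> set \<Sigma>" "RecDecl r A' N' \<in> set \<Sigma>"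
  shows "A = A'" "N = N'"
  using inj_onD[OF assms(1) _ assms(2,3)] by simp_all

lemma hnf_functional:
  assumes \<Sigma>: "inj_on decl_name (set \<Sigma>)"
  shows "hnf \<Sigma> M h S \<Longrightarrow> hnf \<Sigma> M h' S' \<Longrightarrow> h = h' \<and> S = S'"
proof (induction arbitrary: h' S' rule: hnf.induct)
  case (hnf_Rec r A N S R h S'')
  from hnf_Rec.prems obtain A' N' R' where
    R': "RecDecl r A' N' \<in> set \<Sigma>" "hred N' S R'" "hnf \<Sigma> R' h' S'"
    by (auto simp: hnf_Rec_iff)
  have "N' = N" using RecDecl_unique(2)[OF \<Sigma> R'(1) hnf_Rec.hyps(1)] .
  then have "R' = R" using R'(2) hnf_Rec.hyps(2) hsub_hred_functional(3) by blast
  with R'(3) show ?case using hnf_Rec.IH by blast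
qed (simp_all add: hnf_Var_iff hnf_Con_iff)

lemma unfolds_functional:
  assumes \<Sigma>: "inj_on decl_name (set \<Sigma>)" and "unfolds \<Sigma> M T" "unfolds \<Sigma> M T'"
  shows "T = T'"
proof -
  let ?R = "(unfolds \<Sigma>)\<inverse>\<inverse> OO unfolds \<Sigma>"
  have "?R T T'" using assms(2,3) by blast
  then show ?thesis
  proof (coinduct rule: btree.coinduct[consumes 1])
    case (Eq_btree T T')
    then obtain M where M: "unfolds \<Sigma> M T" "unfolds \<Sigma> M T'" by blast
    show ?case
    proof (cases M)
      case (Lam m M')
      with M show ?thesis by (auto simp: unfolds_Lam_iff hnf_Lam_iff)
    next
      case (App h S)
      from M[unfolded App unfolds_App_iff] obtain h1 S1 Ts h2 S2 Ts' where
        T: "T = BApp h1 Ts" "T' = BApp h2 Ts'"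
        and hnf: "hnf \<Sigma> (App h S) h1 S1" "hnf \<Sigma> (App h S) h2 S2"
        and args: "list_all2 (rel_arg (unfolds \<Sigma>)) S1 Ts" "list_all2 (rel_arg (unfolds \<Sigma>)) S2 Ts'"
        by blast
      have eq: "h1 = h2" "S1 = S2" using hnf_functional[OF \<Sigma> hnf] by simp_all
      with args have "list_all2 (rel_arg ?R) Ts Ts'"
        by (auto simp: arg.rel_compp list.rel_compp arg.rel_conversep list.rel_conversep)
      with eq(1) show ?thesis unfolding T by (simp del: conversep_iff)
    qed
  qed
qed

lemma unfolds_App_hnf_iff:
  assumes "inj_on decl_name (set \<Sigma>)" "hnf \<Sigma> (App h S) h' S'"
  shows "unfolds \<Sigma> (App h S) T \<longleftrightarrow> (\<exists>Ts. T = BApp h' Ts \<and> list_all2 (rel_arg (unfolds \<Sigma>)) S' Ts)"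
  unfolding unfolds_App_iff using hnf_functional[OF assms(1)] assms(2) by blast

lemma tm_eq_trans:
  assumes "inj_on decl_name (set \<Sigma>)" "tm_eq \<Sigma> M N" "tm_eq \<Sigma> N P"
  shows "tm_eq \<Sigma> M P"
  using assms unfolds_functional unfolding tm_eq_def by metis

lemma ty_eq_trans:
  assumes \<Sigma>: "inj_on decl_name (set \<Sigma>)"
  shows "ty_eq \<Sigma> A B \<Longrightarrow> ty_eq \<Sigma> B C \<Longrightarrow> ty_eq \<Sigma> A C"
proof (induction A arbitrary: B C)
  case (Atom a S)
  then obtain S' S'' where eqs: "C = Atom a S''"
    "list_all2 (rel_arg (tm_eq \<Sigma>)) S S'" "list_all2 (rel_arg (tm_eq \<Sigma>)) S' S''"
    by (auto simp: ty_eq_Atom_iff)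
  have "tm_eq \<Sigma> OO tm_eq \<Sigma> \<le> tm_eq \<Sigma>" using tm_eq_trans[OF \<Sigma>] by blast
  then have "list_all2 (rel_arg (tm_eq \<Sigma> OO tm_eq \<Sigma>)) \<le> list_all2 (rel_arg (tm_eq \<Sigma>))"
    by (intro list.rel_mono arg.rel_mono)
  moreover have "list_all2 (rel_arg (tm_eq \<Sigma> OO tm_eq \<Sigma>)) S S''"
    using eqs(2,3) by (auto simp: arg.rel_compp list.rel_compp)
  ultimately show ?case unfolding eqs(1) ty_eq_Atom_iff by blast
next
  case (Pi m A1 A2)
  then show ?case by (auto simp: ty_eq_Pi_iff)
qed


section \<open>Closed terms\<close>

inductive scoped :: "nat \<Rightarrow> ('c, 'r) tm \<Rightarrow> bool" where
  scoped_Lam: "scoped (Suc n) M \<Longrightarrow> scoped n (Lam m M)"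
| scoped_App: "(\<And>i. h = Var i \<Longrightarrow> i < n) \<Longrightarrow> (\<And>M. Arg M \<in> set S \<Longrightarrow> scoped n M) \<Longrightarrow>
    (\<And>i. PArg i \<in> set S \<Longrightarrow> i < n) \<Longrightarrow> scoped n (App h S)"

lemma scoped_if_typed:
  shows "chk \<Sigma> \<Gamma> M A \<Longrightarrow> scoped (length \<Gamma>) M"
    and "syn \<Sigma> \<Gamma> R P \<Longrightarrow> scoped (length \<Gamma>) R"
    and "spn \<Sigma> \<Gamma> S A P \<Longrightarrow>
      (\<forall>M. Arg M \<in> set S \<longrightarrow> scoped (length \<Gamma>) M) \<and> (\<forall>i. PArg i \<in> set S \<longrightarrow> i < length \<Gamma>)"
  by (induction rule: chk_syn_spn.inducts) (auto intro!: scoped.intros simp: lookup_def)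

lemma ren_scoped:
  assumes "scoped n M" "\<And>i. i < n \<Longrightarrow> f i = i"
  shows "ren f M = M"
  using assms
proof (induction arbitrary: f)
  case (scoped_Lam n M m)
  have "up f i = i" if "i < Suc n" for i using that scoped_Lam.prems by (cases i) auto
  with scoped_Lam show ?case by simp
next
  case (scoped_App h n S)
  have "ren_head f h = h" using scoped_App by (cases h) auto
  moreover have "map (ren_arg f) S = S"
  proof (rule map_idI)
    fix a assume "a \<in> set S"
    with scoped_App show "ren_arg f a = a" by (cases a) auto
  qed
  ultimately show ?case by simp
qed

lemma hsubs_refl:
  assumes "\<And>M. Arg M \<in> set S \<Longrightarrow> hsub N k M M" "\<And>i. PArg i \<in> set S \<Longrightarrow> i < k"
  shows "hsubs N k S S"
  using assms
proof (induction S)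
  case (Cons a S)
  then show ?case by (cases a) (auto intro: hsub_hsubs_hred.intros)
qed (rule hsubs_Nil)

lemma hsub_scoped:
  assumes "scoped n M" "n \<le> k"
  shows "hsub N k M M"
  using assms
proof (induction arbitrary: N k)
  case (scoped_App h n S)
  then have "hsubs N k S S" by (intro hsubs_refl) (auto intro: less_le_trans)
  with scoped_App show ?case by (cases h) (auto intro: hsub_hsubs_hred.intros)
qed (auto intro: hsub_Lam)

lemma hsub_closed_iff: "scoped 0 M \<Longrightarrow> hsub N k M R \<longleftrightarrow> R = M"
  using hsub_scoped hsub_hred_functional(1) by blast


section \<open>Closed terms of atomic type\<close>

inductive_simps chk_Atom_iff: "chk \<Sigma> \<Gamma> M (Atom a S)"
inductive_simps syn_Var_iff: "syn \<Sigma> \<Gamma> (App (Var i) S) P"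
inductive_simps syn_Con_iff: "syn \<Sigma> \<Gamma> (App (Con c) S) P"
inductive_simps syn_Rec_iff: "syn \<Sigma> \<Gamma> (App (Rec r) S) P"
inductive_simps spn_Atom_iff: "spn \<Sigma> \<Gamma> S (Atom a S') P"
inductive_simps spn_Pi_Ord_iff: "spn \<Sigma> \<Gamma> S (Pi Ord A B) P"
inductive_simps kspn_Cotype_iff: "kspn \<Sigma> \<Gamma> S Cotype"
inductive_simps kspn_KPi_Ord_iff: "kspn \<Sigma> \<Gamma> S (KPi Ord A K)"
inductive_simps wf_ty_Atom_iff: "wf_ty \<Sigma> \<Gamma> (Atom a S)"
inductive_simps wf_ty_Pi_iff: "wf_ty \<Sigma> \<Gamma> (Pi m A B)"
inductive_simps wf_kd_Cotype_iff: "wf_kd \<Sigma> \<Gamma> Cotype"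
inductive_simps wf_kd_KPi_iff: "wf_kd \<Sigma> \<Gamma> (KPi m A K)"

lemma chk_Nil_ren: "chk \<Sigma> [] M A \<Longrightarrow> ren f M = M"
  using scoped_if_typed(1) ren_scoped by fastforce

lemma chk_Nil_hsub_iff: "chk \<Sigma> [] M A \<Longrightarrow> hsub N k M R \<longleftrightarrow> R = M"
  using scoped_if_typed(1) hsub_closed_iff by fastforce

lemma chk_Nil_hred_Nil_iff: "chk \<Sigma> [] M (Atom a S) \<Longrightarrow> hred M [] R \<longleftrightarrow> R = M"
  by (auto simp: chk_Atom_iff hred_App_iff)

primrec subtms :: "('c, 'r) tm \<Rightarrow> ('c, 'r) tm set" where
  "subtms (Lam m M) = insert (Lam m M) (subtms M)"
| "subtms (App h S) = insert (App h S) (\<Union> (\<Union> (set_arg ` set (map (map_arg subtms) S))))"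

lemma self_in_subtms: "M \<in> subtms M"
  by (cases M) auto

lemma finite_subtms: "finite (subtms M)"
  by (induction M) (auto simp: arg.set_map)

lemma arg_in_subtms: "App h S \<in> subtms M \<Longrightarrow> Arg N \<in> set S \<Longrightarrow> N \<in> subtms M"
proof (induction M)
  case (App h' S')
  show ?case
  proof (cases "App h S = App h' S'")
    case True
    with App.prems have "Arg N \<in> set S'" by simp
    then show ?thesis using self_in_subtms[of N] by (force simp: arg.set_map)
  next
    case False
    with App.prems obtain a M where "a \<in> set S'" "M \<in> set_arg a" "App h S \<in> subtms M"
      by (auto simp: arg.set_map)
    with App show ?thesis by (force simp: arg.set_map)
  qed
qed auto

text \<open>
  A finite set that contains every term met when \<open>M\<close> is explored by unfolding recursion constants
  and passing to arguments, provided that the recursion constants are never applied.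
\<close>

definition reach :: "('a, 'c, 'r) lfsig \<Rightarrow> ('c, 'r) tm \<Rightarrow> ('c, 'r) tm set" where
  "reach \<Sigma> M = subtms M \<union> (\<Union>(r, A, N) \<in> {(r, A, N). RecDecl r A N \<in> set \<Sigma>}. subtms N)"

lemma finite_reach: "finite (reach \<Sigma> M)"
proof -
  have "{(r, A, N). RecDecl r A N \<in> set \<Sigma>} = (\<lambda>(r, A, N). RecDecl r A N) -` set \<Sigma>" by auto
  also have "finite \<dots>" by (intro finite_vimageI) (auto simp: inj_on_def)
  finally show ?thesis by (auto simp: reach_def finite_subtms)
qed

definition exposes :: "('a, 'c, 'r) lfsig \<Rightarrow> ('c, 'r) tm \<Rightarrow> 'c \<Rightarrow> ('c, 'r) tm arg list \<Rightarrow> bool" where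
  "exposes \<Sigma> M c S \<longleftrightarrow> M = App (Con c) S \<or>
     (\<exists>r A. M = App (Rec r) [] \<and> RecDecl r A (App (Con c) S) \<in> set \<Sigma>)"

lemma hnf_if_exposes: "exposes \<Sigma> M c S \<Longrightarrow> hnf \<Sigma> M (BCon c) S"
  by (auto simp: exposes_def intro: hnf.intros hred_Nil)

lemma unfolds_exposes_iff:
  assumes "inj_on decl_name (set \<Sigma>)" "exposes \<Sigma> M c S"
  shows "unfolds \<Sigma> M T \<longleftrightarrow> (\<exists>Ts. T = BApp (BCon c) Ts \<and> list_all2 (rel_arg (unfolds \<Sigma>)) S Ts)"
  using assms(2) unfolds_App_hnf_iff[OF assms(1)] hnf_if_exposes[OF assms(2)]
  by (auto simp: exposes_def)

lemma exposes_arg_in_reach: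
  assumes "exposes \<Sigma> N c S" "N \<in> reach \<Sigma> M" "Arg N' \<in> set S"
  shows "N' \<in> reach \<Sigma> M"
proof -
  have "App (Con c) S \<in> reach \<Sigma> M"
    using assms(1,2) self_in_subtms unfolding exposes_def reach_def by blast
  with assms(3) show ?thesis unfolding reach_def using arg_in_subtms by blast
qed

text \<open>
  In the empty context there are no prepattern variables, so a recursion constant can only occur
  unapplied there, and by contractiveness its definition starts with a constructor.
\<close>

lemma syn_Nil_RecE:
  assumes \<Sigma>: "wf_sig \<Sigma>" and syn: "syn \<Sigma> [] (App (Rec r) S) P"
  obtains c S' where "S = []" "RecDecl r P (App (Con c) S') \<in> set \<Sigma>"
    "chk \<Sigma> [] (App (Con c) S') P"
proof -
  from syn obtain A N where decl: "RecDecl r A N \<in> set \<Sigma>" and spn: "spn \<Sigma> [] S A P"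
    by (auto simp: syn_Rec_iff)
  with \<Sigma> have N: "prepattern A" "chk \<Sigma> [] N A" "contractive N" by (auto simp: wf_sig_def)
  from spn N(1) obtain a J where A: "A = Atom a J" "S = []" "P = A"
    by cases (auto simp: lookup_def)
  with N(2) obtain h S' P' where N_eq: "N = App h S'" and "syn \<Sigma> [] (App h S') P'"
    by (auto simp: chk_Atom_iff)
  with N(3) obtain c where "h = Con c"
    by (cases h) (auto simp: syn_Var_iff lookup_def)
  with that decl N(2) show ?thesis by (simp add: N_eq A)
qed

lemma chk_Nil_AtomE:
  assumes \<Sigma>: "wf_sig \<Sigma>" and M: "chk \<Sigma> [] M (Atom a J)"
  obtains c S A P where "exposes \<Sigma> M c S" "ConDecl c A \<in> set \<Sigma>" "spn \<Sigma> [] S A P"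
    "ty_eq \<Sigma> P (Atom a J)"
proof -
  from M obtain h S P where M_eq: "M = App h S" and syn: "syn \<Sigma> [] (App h S) P"
    and eq: "ty_eq \<Sigma> P (Atom a J)"
    by (auto simp: chk_Atom_iff)
  have "\<exists>c S' P'. exposes \<Sigma> M c S' \<and> syn \<Sigma> [] (App (Con c) S') P' \<and> ty_eq \<Sigma> P' (Atom a J)"
  proof (cases h)
    case (Var i)
    with syn show ?thesis by (simp add: syn_Var_iff lookup_def)
  next
    case (Con c)
    with M_eq syn eq show ?thesis by (auto simp: exposes_def)
  next
    case (Rec r)
    from syn_Nil_RecE[OF \<Sigma> syn[unfolded Rec]] obtain c S' where "S = []"
      "RecDecl r P (App (Con c) S') \<in> set \<Sigma>" and body: "chk \<Sigma> [] (App (Con c) S') P" .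
    then have "exposes \<Sigma> M c S'" by (auto simp: exposes_def M_eq Rec)
    moreover from eq obtain J' where "P = Atom a J'" by (auto simp: ty_eq_Atom_right_iff)
    with body obtain P' where "syn \<Sigma> [] (App (Con c) S') P'" "ty_eq \<Sigma> P' P"
      by (auto simp: chk_Atom_iff)
    ultimately show ?thesis using ty_eq_trans[OF inj_decl_name_if_wf_sig[OF \<Sigma>] _ eq] by blast
  qed
  with that show ?thesis by (auto simp: syn_Con_iff)
qed


section \<open>The rules for emptiness\<close>

fun ptyp_con :: "'x ptyp \<Rightarrow> con" where
  "ptyp_con (TimesT x y) = times"
| "ptyp_con OneT = one"
| "ptyp_con (PlusT x y) = plus"
| "ptyp_con ZeroT = zero"

fun ptyp_args :: "'x ptyp \<Rightarrow> 'x list" where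
  "ptyp_args (TimesT x y) = [x, y]"
| "ptyp_args OneT = []"
| "ptyp_args (PlusT x y) = [x, y]"
| "ptyp_args ZeroT = []"

lemma set_ptyp_args: "set (ptyp_args \<tau>) = set_ptyp \<tau>"
  by (cases \<tau>) auto

lemma ptyp_con_map: "ptyp_con (map_ptyp f \<tau>) = ptyp_con \<tau>"
  by (cases \<tau>) auto

lemma ptyp_args_map: "ptyp_args (map_ptyp f \<tau>) = map f (ptyp_args \<tau>)"
  by (cases \<tau>) auto

lemma rel_ptyp_iff_con_args:
  "rel_ptyp R \<pi> \<tau> \<longleftrightarrow> ptyp_con \<pi> = ptyp_con \<tau> \<and> list_all2 R (ptyp_args \<pi>) (ptyp_args \<tau>)"
  by (cases \<pi>; cases \<tau>) auto

text \<open>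
  \<open>emptiness_rule c \<tau> xs\<close>: the rule encoded by \<open>c\<close> infers emptiness of \<open>\<tau>\<close> from emptiness of \<open>xs\<close>.
  The components \<open>'x\<close> are type names in derivations, and terms of type \<open>postp\<close> in CoLF.
\<close>

inductive emptiness_rule :: "con \<Rightarrow> 'x ptyp \<Rightarrow> 'x list \<Rightarrow> bool" where
  emptiness_rule_zero_emp: "emptiness_rule zero_emp ZeroT []"
| emptiness_rule_plus_emp: "emptiness_rule plus_emp (PlusT x y) [x, y]"
| emptiness_rule_times_emp_1: "emptiness_rule times_emp_1 (TimesT x y) [x]"
| emptiness_rule_times_emp_2: "emptiness_rule times_emp_2 (TimesT x y) [y]"

inductive_simps not_emptiness_rule [simp]:
  "emptiness_rule times \<tau> xs" "emptiness_rule one \<tau> xs" "emptiness_rule plus \<tau> xs"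
  "emptiness_rule zero \<tau> xs"

inductive_simps emptiness_rule_iffs:
  "emptiness_rule zero_emp \<tau> xs" "emptiness_rule plus_emp \<tau> xs"
  "emptiness_rule times_emp_1 \<tau> xs" "emptiness_rule times_emp_2 \<tau> xs"

lemma ex_emptiness_rule_iffs:
  "(\<exists>\<tau> xs. emptiness_rule zero_emp \<tau> xs \<and> Q \<tau> xs) \<longleftrightarrow> Q ZeroT []"
  "(\<exists>\<tau> xs. emptiness_rule plus_emp \<tau> xs \<and> Q \<tau> xs) \<longleftrightarrow> (\<exists>x y. Q (PlusT x y) [x, y])"
  "(\<exists>\<tau> xs. emptiness_rule times_emp_1 \<tau> xs \<and> Q \<tau> xs) \<longleftrightarrow> (\<exists>x y. Q (TimesT x y) [x])"
  "(\<exists>\<tau> xs. emptiness_rule times_emp_2 \<tau> xs \<and> Q \<tau> xs) \<longleftrightarrow> (\<exists>x y. Q (TimesT x y) [y])"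
  by (auto simp: emptiness_rule_iffs)

lemma emptiness_rule_functional: "emptiness_rule c \<tau> xs \<Longrightarrow> emptiness_rule c \<tau> ys \<Longrightarrow> xs = ys"
  by (erule emptiness_rule.cases) (auto simp: emptiness_rule_iffs)

lemma emptiness_rule_premises_subset: "emptiness_rule c \<tau> xs \<Longrightarrow> set xs \<subseteq> set_ptyp \<tau>"
  by (erule emptiness_rule.cases) auto

lemma emptiness_rule_map: "emptiness_rule c \<tau> xs \<Longrightarrow> emptiness_rule c (map_ptyp f \<tau>) (map f xs)"
  by (erule emptiness_rule.cases) (auto simp: emptiness_rule_iffs)

lemma emptiness_rule_rel:
  assumes "emptiness_rule c \<tau> xs" "rel_ptyp R \<tau> \<tau>'"
  obtains ys where "emptiness_rule c \<tau>' ys" "list_all2 R xs ys"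
  using assms by (cases; cases \<tau>') (auto simp: emptiness_rule_iffs)


section \<open>Derivations as trees of rule instances\<close>

fun conclusion :: "'t deriv \<Rightarrow> 't" where
  "conclusion (ZeroEmp t) = t"
| "conclusion (PlusEmp t d1 d2) = t"
| "conclusion (TimesEmp1 t d) = t"
| "conclusion (TimesEmp2 t d) = t"

fun last_rule :: "'t deriv \<Rightarrow> con" where
  "last_rule (ZeroEmp t) = zero_emp"
| "last_rule (PlusEmp t d1 d2) = plus_emp"
| "last_rule (TimesEmp1 t d) = times_emp_1"
| "last_rule (TimesEmp2 t d) = times_emp_2"

fun direct_subderivs :: "'t deriv \<Rightarrow> 't deriv list" where
  "direct_subderivs (ZeroEmp t) = []"
| "direct_subderivs (PlusEmp t d1 d2) = [d1, d2]"
| "direct_subderivs (TimesEmp1 t d) = [d]"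
| "direct_subderivs (TimesEmp2 t d) = [d]"

lemma deriv_bisimilar_imp_eq:
  assumes "X d e"
    and "\<And>d e. X d e \<Longrightarrow> conclusion d = conclusion e \<and> last_rule d = last_rule e \<and>
      list_all2 X (direct_subderivs d) (direct_subderivs e)"
  shows "d = e"
  using assms(1)
proof (coinduct rule: deriv.coinduct[consumes 1])
  case (Eq_deriv d e)
  then show ?case using assms(2)[OF Eq_deriv] by (cases d; cases e) simp_all
qed

lemma derives_iff:
  "derives \<Omega> d t \<longleftrightarrow> conclusion d = t \<and> (\<exists>\<tau> ts. (t, \<tau>) \<in> set \<Omega> \<and>
     emptiness_rule (last_rule d) \<tau> ts \<and> list_all2 (derives \<Omega>) (direct_subderivs d) ts)"
  by (subst derives.simps, cases d) (auto simp: emptiness_rule_iffs)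

lemma derives_coinduct:
  assumes "X d t"
    and "\<And>d t. X d t \<Longrightarrow> conclusion d = t \<and> (\<exists>\<tau> ts. (t, \<tau>) \<in> set \<Omega> \<and>
      emptiness_rule (last_rule d) \<tau> ts \<and> list_all2 X (direct_subderivs d) ts)"
  shows "derives \<Omega> d t"
  using assms(1)
proof (coinduct rule: derives.coinduct)
  case (derives d t)
  then show ?case using assms(2)[OF derives] by (cases d) (auto simp: emptiness_rule_iffs)
qed

lemma derives_conclusion: "derives \<Omega> d t \<Longrightarrow> conclusion d = t"
  by (simp add: derives_iff)

lemma derives_root:
  assumes "derives \<Omega> d t"
  obtains \<tau> where "(t, \<tau>) \<in> set \<Omega>"
    "emptiness_rule (last_rule d) \<tau> (map conclusion (direct_subderivs d))"
proof -
  from assms obtain \<tau> ts where \<tau>: "(t, \<tau>) \<in> set \<Omega>" "emptiness_rule (last_rule d) \<tau> ts"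
    and ds: "list_all2 (derives \<Omega>) (direct_subderivs d) ts"
    by (auto simp: derives_iff[of \<Omega> d])
  from ds have "map conclusion (direct_subderivs d) = ts"
    by induction (simp_all add: derives_conclusion)
  with \<tau> that show ?thesis by blast
qed

lemma direct_subderivs_in_subderivs:
  assumes "e \<in> subderivs d" "e' \<in> set (direct_subderivs e)"
  shows "e' \<in> subderivs d"
  using assms by (cases e rule: deriv.exhaust) (auto intro: subderivs.intros)

lemma subderivs_direct_induct [consumes 1, case_names refl direct]:
  assumes "e \<in> subderivs d" and "P d"
    and step: "\<And>e e'. P e \<Longrightarrow> e' \<in> set (direct_subderivs e) \<Longrightarrow> P e'"
  shows "P e"
  using assms(1) by induction (use assms(2) step in force)+

lemma derives_subderiv:
  assumes "e \<in> subderivs d" "derives \<Omega> d t"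
  shows "derives \<Omega> e (conclusion e)"
  using assms(1)
proof (induction rule: subderivs_direct_induct)
  case refl
  show ?case using assms(2) derives_conclusion by metis
next
  case (direct e e')
  then obtain u where "derives \<Omega> e' u"
    unfolding derives_iff[of \<Omega> e] list_all2_conv_all_nth in_set_conv_nth by blast
  then show ?case using derives_conclusion by metis
qed

text \<open>
  Meaningful only at states \<open>s\<close> where \<open>rule s\<close> encodes a rule with \<open>length (succs s)\<close> premises.
\<close>

primcorec deriv_unfold ::
  "('s \<Rightarrow> con) \<Rightarrow> ('s \<Rightarrow> 't) \<Rightarrow> ('s \<Rightarrow> 's list) \<Rightarrow> 's \<Rightarrow> 't deriv" where
  "deriv_unfold rule concl succs s =
    (if rule s = plus_emp then PlusEmp (concl s) (deriv_unfold rule concl succs (succs s ! 0))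
       (deriv_unfold rule concl succs (succs s ! 1))
     else if rule s = times_emp_1
       then TimesEmp1 (concl s) (deriv_unfold rule concl succs (succs s ! 0))
     else if rule s = times_emp_2
       then TimesEmp2 (concl s) (deriv_unfold rule concl succs (succs s ! 0))
     else ZeroEmp (concl s))"

lemma deriv_unfold_simps:
  fixes concl :: "'s \<Rightarrow> 't"
  assumes "emptiness_rule (rule s) \<tau> (map concl (succs s))"
  shows "conclusion (deriv_unfold rule concl succs s) = concl s"
    and "last_rule (deriv_unfold rule concl succs s) = rule s"
    and "direct_subderivs (deriv_unfold rule concl succs s) =
      map (deriv_unfold rule concl succs) (succs s)"
  using assms
  by (auto elim!: emptiness_rule.cases simp: deriv_unfold.code[of rule concl succs s])

lemma derives_deriv_unfold:
  fixes concl :: "'s \<Rightarrow> 't"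
  assumes "s \<in> X"
    and rule: "\<And>s. s \<in> X \<Longrightarrow>
      \<exists>\<tau>. (concl s, \<tau>) \<in> set \<Omega> \<and> emptiness_rule (rule s) \<tau> (map concl (succs s))"
    and succs: "\<And>s. s \<in> X \<Longrightarrow> set (succs s) \<subseteq> X"
  shows "derives \<Omega> (deriv_unfold rule concl succs s) (concl s)"
proof -
  let ?d = "deriv_unfold rule concl succs"
  let ?Y = "\<lambda>d t. \<exists>s \<in> X. d = ?d s \<and> t = concl s"
  have "?Y (?d s) (concl s)" using assms(1) by blast
  then show ?thesis
  proof (rule derives_coinduct)
    fix d t assume "?Y d t"
    then obtain s where s: "s \<in> X" "d = ?d s" "t = concl s" by blast
    from rule[OF s(1)] obtain \<tau> where \<tau>: "(concl s, \<tau>) \<in> set \<Omega>"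
      "emptiness_rule (rule s) \<tau> (map concl (succs s))" by blast
    moreover have "list_all2 ?Y (map ?d (succs s)) (map concl (succs s))"
      unfolding list.rel_map by (rule list.rel_refl_strong) (use succs[OF s(1)] in blast)
    ultimately show "conclusion d = t \<and> (\<exists>\<tau> ts. (t, \<tau>) \<in> set \<Omega> \<and>
        emptiness_rule (last_rule d) \<tau> ts \<and> list_all2 ?Y (direct_subderivs d) ts)"
      unfolding s(2,3)
        deriv_unfold_simps[where rule = rule and concl = concl and succs = succs, OF \<tau>(2)]
      by blast
  qed
qed

lemma subderivs_deriv_unfold_subset:
  fixes concl :: "'s \<Rightarrow> 't"
  assumes "s \<in> X"
    and rule: "\<And>s. s \<in> X \<Longrightarrow> \<exists>\<tau>. emptiness_rule (rule s) \<tau> (map concl (succs s))"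
    and succs: "\<And>s. s \<in> X \<Longrightarrow> set (succs s) \<subseteq> X"
  shows "subderivs (deriv_unfold rule concl succs s) \<subseteq> deriv_unfold rule concl succs ` X"
proof
  let ?d = "deriv_unfold rule concl succs"
  fix e assume "e \<in> subderivs (?d s)"
  then show "e \<in> ?d ` X"
  proof (induction rule: subderivs_direct_induct)
    case refl
    show ?case using assms(1) by blast
  next
    case (direct e e')
    then obtain s where s: "s \<in> X" "e = ?d s" by blast
    from rule[OF s(1)] have "direct_subderivs e = map ?d (succs s)"
      unfolding s(2) by (blast intro: deriv_unfold_simps(3))
    with direct.hyps succs[OF s(1)] show ?case by auto
  qed
qed

lemma circular_derivation_deriv_unfold:
  fixes concl :: "'s \<Rightarrow> 't"
  assumes "finite X" "s \<in> X"
    and rule: "\<And>s. s \<in> X \<Longrightarrow>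
      \<exists>\<tau>. (concl s, \<tau>) \<in> set \<Omega> \<and> emptiness_rule (rule s) \<tau> (map concl (succs s))"
    and succs: "\<And>s. s \<in> X \<Longrightarrow> set (succs s) \<subseteq> X"
  shows "deriv_unfold rule concl succs s \<in> circular_derivations \<Omega> (concl s)"
proof -
  let ?d = "deriv_unfold rule concl succs"
  have "derives \<Omega> (?d s) (concl s)"
    using assms(2-) by (rule derives_deriv_unfold)
  moreover have "subderivs (?d s) \<subseteq> ?d ` X"
    using assms(2) by (rule subderivs_deriv_unfold_subset) (use rule succs in blast)+
  ultimately show ?thesis
    using finite_subset[OF _ finite_imageI[OF assms(1)]] by (auto simp: circular_derivations_def)
qed


section \<open>Boehm trees of type names and derivations\<close>

definition definiens :: "'t osig \<Rightarrow> 't \<Rightarrow> 't ptyp" where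
  "definiens \<Omega> t = the (map_of \<Omega> t)"

lemma definiens_eq: "wf_osig \<Omega> \<Longrightarrow> (t, \<tau>) \<in> set \<Omega> \<Longrightarrow> definiens \<Omega> t = \<tau>"
  by (simp add: definiens_def wf_osig_def)

lemma ptyp_args_defined: "wf_osig \<Omega> \<Longrightarrow> (t, \<tau>) \<in> set \<Omega> \<Longrightarrow> set (ptyp_args \<tau>) \<subseteq> fst ` set \<Omega>"
  by (auto simp: wf_osig_def set_ptyp_args)

text \<open>
  The trees of interest denote type names or derivations; putting both into one sum type makes a
  derivation tree, with its implicit arguments, definable by a single corecursion.
\<close>

fun tree_con :: "'t osig \<Rightarrow> 't + 't deriv \<Rightarrow> con" where
  "tree_con \<Omega> (Inl t) = ptyp_con (definiens \<Omega> t)"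
| "tree_con \<Omega> (Inr d) = last_rule d"

fun tree_children :: "'t osig \<Rightarrow> 't + 't deriv \<Rightarrow> ('t + 't deriv) list" where
  "tree_children \<Omega> (Inl t) = map Inl (ptyp_args (definiens \<Omega> t))"
| "tree_children \<Omega> (Inr d) =
    map Inl (ptyp_args (definiens \<Omega> (conclusion d))) @ map Inr (direct_subderivs d)"

primcorec tree_of :: "'t osig \<Rightarrow> 't + 't deriv \<Rightarrow> con btree" where
  "tree_of \<Omega> x =
     BApp (BCon (tree_con \<Omega> x)) (map (map_arg (tree_of \<Omega>)) (map Arg (tree_children \<Omega> x)))"

abbreviation name_tree :: "'t osig \<Rightarrow> 't \<Rightarrow> con btree" where
  "name_tree \<Omega> t \<equiv> tree_of \<Omega> (Inl t)"

abbreviation deriv_tree :: "'t osig \<Rightarrow> 't deriv \<Rightarrow> con btree" where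
  "deriv_tree \<Omega> d \<equiv> tree_of \<Omega> (Inr d)"

lemma tree_of_unfold:
  "tree_of \<Omega> x = BApp (BCon (tree_con \<Omega> x)) (map Arg (map (tree_of \<Omega>) (tree_children \<Omega> x)))"
  by (subst tree_of.code) simp

lemma tree_of_eq_iff:
  "tree_of \<Omega> x = tree_of \<Omega> y \<longleftrightarrow> tree_con \<Omega> x = tree_con \<Omega> y \<and>
     map (tree_of \<Omega>) (tree_children \<Omega> x) = map (tree_of \<Omega>) (tree_children \<Omega> y)"
  using tree_of_unfold[of \<Omega> x] tree_of_unfold[of \<Omega> y]
  by (metis arg.inject(1) bhead.inject(2) btree.inject(2) inj_map_eq_map injI)

lemma direct_subderivs_conclusions_agree:
  assumes "wf_osig \<Omega>" "derives \<Omega> d t" "derives \<Omega> e t" "last_rule d = last_rule e"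
  shows "list_all2 (\<lambda>d e. \<exists>u. derives \<Omega> d u \<and> derives \<Omega> e u)
    (direct_subderivs d) (direct_subderivs e)"
proof -
  from assms(2) obtain \<tau> ts where \<tau>: "(t, \<tau>) \<in> set \<Omega>" "emptiness_rule (last_rule d) \<tau> ts"
    and ds: "list_all2 (derives \<Omega>) (direct_subderivs d) ts"
    by (auto simp: derives_iff[of \<Omega> d])
  from assms(3) obtain \<tau>' us where \<tau>': "(t, \<tau>') \<in> set \<Omega>" "emptiness_rule (last_rule e) \<tau>' us"
    and es: "list_all2 (derives \<Omega>) (direct_subderivs e) us"
    by (auto simp: derives_iff[of \<Omega> e])
  have "\<tau> = \<tau>'" using definiens_eq[OF assms(1)] \<tau>(1) \<tau>'(1) by blast
  with \<tau>(2) \<tau>'(2) assms(4) have "ts = us" using emptiness_rule_functional by metis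
  with ds es show ?thesis by (fastforce simp: list_all2_conv_all_nth)
qed

lemma inj_on_deriv_tree:
  assumes "wf_osig \<Omega>"
  shows "inj_on (deriv_tree \<Omega>) {d. derives \<Omega> d t}"
proof (rule inj_onI)
  let ?X = "\<lambda>d e. (\<exists>t. derives \<Omega> d t \<and> derives \<Omega> e t) \<and> deriv_tree \<Omega> d = deriv_tree \<Omega> e"
  fix d e assume "d \<in> {d. derives \<Omega> d t}" "e \<in> {d. derives \<Omega> d t}" "deriv_tree \<Omega> d = deriv_tree \<Omega> e"
  then have "?X d e" by blast
  then show "d = e"
  proof (rule deriv_bisimilar_imp_eq)
    fix d e assume "?X d e"
    then obtain t where d: "derives \<Omega> d t" and e: "derives \<Omega> e t"
      and tree: "deriv_tree \<Omega> d = deriv_tree \<Omega> e" by blast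
    have concl: "conclusion d = conclusion e" using d e derives_conclusion by metis
    with tree have rule: "last_rule d = last_rule e"
      and trees: "map (deriv_tree \<Omega>) (direct_subderivs d) = map (deriv_tree \<Omega>) (direct_subderivs e)"
      by (simp_all add: tree_of_eq_iff comp_def)
    from trees have "list_all2 (\<lambda>d e. deriv_tree \<Omega> d = deriv_tree \<Omega> e)
        (direct_subderivs d) (direct_subderivs e)"
      unfolding list.rel_eq[symmetric] list.rel_map .
    with direct_subderivs_conclusions_agree[OF assms d e rule]
    have "list_all2 ?X (direct_subderivs d) (direct_subderivs e)"
      by (simp add: list_all2_conv_all_nth)
    with concl rule show "conclusion d = conclusion e \<and> last_rule d = last_rule e \<and>
        list_all2 ?X (direct_subderivs d) (direct_subderivs e)" by blast
  qed
qed

lemma unfolds_tree_of_coinduct: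
  assumes "X D x"
    and step: "\<And>D x. X D x \<Longrightarrow> \<exists>Ds. exposes \<Sigma> D (tree_con \<Omega> x) (map Arg Ds) \<and>
      list_all2 (\<lambda>D x. X D x \<or> unfolds \<Sigma> D (tree_of \<Omega> x)) Ds (tree_children \<Omega> x)"
  shows "unfolds \<Sigma> D (tree_of \<Omega> x)"
proof -
  have "\<exists>y. X D y \<and> tree_of \<Omega> x = tree_of \<Omega> y" using assms(1) by blast
  then show ?thesis
  proof (coinduct rule: unfolds.coinduct[where X = "\<lambda>D T. \<exists>x. X D x \<and> T = tree_of \<Omega> x"])
    case (unfolds D T)
    then obtain x where x: "X D x" "T = tree_of \<Omega> x" by blast
    from step[OF x(1)] obtain Ds where
      D: "exposes \<Sigma> D (tree_con \<Omega> x) (map Arg Ds)" and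
      Ds: "list_all2 (\<lambda>D x. X D x \<or> unfolds \<Sigma> D (tree_of \<Omega> x)) Ds (tree_children \<Omega> x)" by blast
    have "list_all2 (rel_arg (\<lambda>D T. (\<exists>x. X D x \<and> T = tree_of \<Omega> x) \<or> unfolds \<Sigma> D T)) (map Arg Ds)
        (map Arg (map (tree_of \<Omega>) (tree_children \<Omega> x)))"
      unfolding list.rel_map using Ds by (rule list.rel_mono_strong) auto
    with hnf_if_exposes[OF D] tree_of_unfold[of \<Omega> x]
    show ?case unfolding x(2) by blast
  qed
qed


section \<open>Typing of the encoding\<close>

lemma rel_arg_Arg_right_iff: "rel_arg R a (Arg y) \<longleftrightarrow> (\<exists>x. a = Arg x \<and> R x y)"
  by (cases a) auto

definition ptyp_term :: "'t etm ptyp \<Rightarrow> 't etm" where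
  "ptyp_term \<pi> = capp (ptyp_con \<pi>) (ptyp_args \<pi>)"

lemma enc_ptyp_eq_ptyp_term: "enc_ptyp \<tau> = ptyp_term (map_ptyp enc_name \<tau>)"
  by (cases \<tau>) (simp_all add: ptyp_term_def)

lemma ex_list_all2_iffs:
  "(\<exists>ys. list_all2 R ys [] \<and> Q ys) \<longleftrightarrow> Q []"
  "(\<exists>ys. list_all2 R ys (x # xs) \<and> Q ys) \<longleftrightarrow> (\<exists>y. R y x \<and> (\<exists>ys. list_all2 R ys xs \<and> Q (y # ys)))"
  by (auto simp: list_all2_Cons2)

text \<open>
  Closed terms are invariant under renaming and hereditary substitution, so the type of the rest of
  a spine is computed by rewriting; \<open>conj_cong\<close> supplies the typings of the preceding arguments,
  which imply that they are closed.
\<close>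

lemma spn_base_sig_empty_iff:
  assumes "ConDecl c A \<in> set base_sig"
  shows "spn \<Sigma> [] S A (empty_ty I) \<longleftrightarrow> (\<exists>\<pi> Ms. emptiness_rule c \<pi> Ms \<and>
    (\<exists>Ds. list_all2 (\<lambda>D M. chk \<Sigma> [] D (empty_ty M)) Ds Ms \<and>
      (\<forall>M \<in> set_ptyp \<pi>. chk \<Sigma> [] M postp_ty) \<and>
      S = map Arg (ptyp_args \<pi> @ Ds) \<and> I = ptyp_term \<pi>))"
  using assms
  unfolding base_sig_def list.set insert_iff decl.inject decl.distinct empty_iff simp_thms
  by (elim disjE conjE)
    (simp_all add: spn_Pi_Ord_iff spn_Atom_iff hsub_ty_Pi_iff hsub_ty_Atom_iff hsub_iffs chk_Nil_ren
      chk_Nil_hsub_iff chk_Nil_hred_Nil_iff ptyp_term_def ex_list_all2_iffs ex_emptiness_rule_iffs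
      cong: conj_cong, auto)

lemma wf_ty_postp: "set base_sig \<subseteq> set \<Sigma> \<Longrightarrow> wf_ty \<Sigma> \<Gamma> postp_ty"
  by (auto simp: wf_ty_Atom_iff kspn_Cotype_iff base_sig_def intro!: exI[of _ Cotype])

lemma wf_ty_empty:
  assumes "set base_sig \<subseteq> set \<Sigma>" "chk \<Sigma> \<Gamma> M postp_ty"
  shows "wf_ty \<Sigma> \<Gamma> (empty_ty M)"
  using assms
  by (auto simp: wf_ty_Atom_iff kspn_Cotype_iff kspn_KPi_Ord_iff hsub_kd_Cotype_iff base_sig_def
      intro!: exI[of _ "KPi Ord postp_ty Cotype"])

lemma chk_App_postp_iff: "chk \<Sigma> \<Gamma> (App h S) postp_ty \<longleftrightarrow> syn \<Sigma> \<Gamma> (App h S) postp_ty"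
  by (auto simp: chk_Atom_iff ty_eq_Atom_iff elim: ty_eq.cases)

lemma chk_ptyp_term:
  fixes \<Sigma> :: "(fam, con, 't rname) lfsig"
  assumes base: "set base_sig \<subseteq> set \<Sigma>" and args: "\<And>M. M \<in> set_ptyp \<pi> \<Longrightarrow> chk \<Sigma> \<Gamma> M postp_ty"
  shows "chk \<Sigma> \<Gamma> (ptyp_term \<pi>) postp_ty"
proof -
  define A :: "'t ety" where
    "A = (case ptyp_args \<pi> of [] \<Rightarrow> postp_ty | _ \<Rightarrow> postp_ty \<rightarrow>\<^sub>o postp_ty \<rightarrow>\<^sub>o postp_ty)"
  have "ConDecl (ptyp_con \<pi>) A \<in> set \<Sigma>"
    using base by (cases \<pi>) (simp_all add: base_sig_def A_def)
  moreover have "spn \<Sigma> \<Gamma> (map Arg (ptyp_args \<pi>)) A postp_ty"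
    using args by (cases \<pi>) (simp_all add: A_def spn_Pi_Ord_iff spn_Atom_iff hsub_ty_Pi_iff
        hsub_ty_Atom_iff hsubs_Nil_iff)
  ultimately show ?thesis unfolding ptyp_term_def chk_App_postp_iff syn_Con_iff by blast
qed

lemma wf_decl_base_sig:
  assumes base: "set base_sig \<subseteq> set \<Sigma>" and d: "d \<in> set base_sig"
  shows "wf_decl \<Sigma> d"
proof -
  have var: "chk \<Sigma> \<Gamma> (dbv i) postp_ty" if "lookup \<Gamma> i m postp_ty" for \<Gamma> i m
    unfolding chk_App_postp_iff syn_Var_iff using that by (blast intro: spn_Nil)
  note terms = chk_ptyp_term[OF base, of ZeroT] chk_ptyp_term[OF base, of "PlusT _ _"]
    chk_ptyp_term[OF base, of "TimesT _ _"]
  show ?thesis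
    using d unfolding base_sig_def
    by (auto simp: wf_ty_Pi_iff wf_kd_KPi_iff wf_kd_Cotype_iff lookup_def
        intro!: wf_ty_postp[OF base] wf_ty_empty[OF base] var
          terms[unfolded ptyp_term_def, simplified])
qed

lemma chk_empty_cong:
  assumes "inj_on decl_name (set \<Sigma>)" "chk \<Sigma> \<Gamma> D (empty_ty M)" "tm_eq \<Sigma> M N"
  shows "chk \<Sigma> \<Gamma> D (empty_ty N)"
proof -
  have "ty_eq \<Sigma> (empty_ty M) (empty_ty N)" using assms(3) by (simp add: ty_eq_Atom_iff)
  with assms(2) show ?thesis unfolding chk_Atom_iff using ty_eq_trans[OF assms(1)] by blast
qed

lemma ex_ConDecl_base_sig: "\<exists>A. ConDecl c A \<in> set base_sig"
  by (cases c) (auto simp: base_sig_def)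

lemma distinct_enc_sig:
  assumes "wf_osig \<Omega>"
  shows "distinct (map decl_name (enc_sig \<Omega>))"
proof -
  let ?recs = "map (\<lambda>(t, \<tau>). RecDecl (TName t) postp_ty (enc_ptyp \<tau>)) \<Omega>"
  have "map decl_name ?recs = map (RecName \<circ> TName) (map fst \<Omega>)"
    by auto
  moreover have "distinct \<dots>"
    using assms by (simp only: wf_osig_def distinct_map[of _ "map fst \<Omega>"]) (simp add: inj_on_def)
  ultimately have "distinct (map decl_name ?recs)" by (simp only:)
  then show ?thesis by (auto simp: enc_sig_def base_sig_def)
qed

locale enc_extension =
  fixes \<Omega> :: "'t osig" and \<Sigma> :: "(fam, con, 't rname) lfsig"
  assumes wf_osig: "wf_osig \<Omega>"
    and enc_sig_subset: "set (enc_sig \<Omega>) \<subseteq> set \<Sigma>"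
    and unique_names: "inj_on decl_name (set \<Sigma>)"
begin

lemma base_sig_subset: "set base_sig \<subseteq> set \<Sigma>"
  using enc_sig_subset by (auto simp: enc_sig_def)

lemma ConDecl_in_base_sig:
  assumes "ConDecl c A \<in> set \<Sigma>"
  shows "ConDecl c A \<in> set base_sig"
proof -
  obtain A' :: "'t ety" where A': "ConDecl c A' \<in> set base_sig" using ex_ConDecl_base_sig by blast
  with inj_onD[OF unique_names _ assms, of "ConDecl c A'"] base_sig_subset show ?thesis by auto
qed

lemma RecDecl_TName:
  assumes "(t, \<tau>) \<in> set \<Omega>"
  shows "RecDecl (TName t) postp_ty (enc_ptyp \<tau>) \<in> set \<Sigma>"
  using assms enc_sig_subset by (force simp: enc_sig_def)

lemma exposes_enc_name:
  assumes "(t, \<tau>) \<in> set \<Omega>"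
  shows "exposes \<Sigma> (enc_name t) (ptyp_con \<tau>) (map Arg (map enc_name (ptyp_args \<tau>)))"
  using RecDecl_TName[OF assms]
  by (auto simp: exposes_def enc_name_def enc_ptyp_eq_ptyp_term ptyp_term_def ptyp_con_map
      ptyp_args_map)

lemma unfolds_enc_name:
  assumes "t \<in> fst ` set \<Omega>"
  shows "unfolds \<Sigma> (enc_name t) (name_tree \<Omega> t)"
proof -
  let ?X = "\<lambda>M (x :: 't + 't deriv). \<exists>t \<in> fst ` set \<Omega>. M = enc_name t \<and> x = Inl t"
  let ?R = "\<lambda>M x. ?X M x \<or> unfolds \<Sigma> M (tree_of \<Omega> x)"
  have "?X (enc_name t) (Inl t)" using assms by blast
  then show ?thesis
  proof (rule unfolds_tree_of_coinduct)
    fix M x assume "?X M x"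
    then obtain t \<tau> where t: "(t, \<tau>) \<in> set \<Omega>" "M = enc_name t" "x = Inl t" by auto
    have "list_all2 ?R (map enc_name (ptyp_args \<tau>)) (map Inl (ptyp_args \<tau>))"
      unfolding list.rel_map
      by (rule list.rel_refl_strong) (use ptyp_args_defined[OF wf_osig t(1)] in blast)
    with exposes_enc_name[OF t(1)] definiens_eq[OF wf_osig t(1)]
    show "\<exists>Ms. exposes \<Sigma> M (tree_con \<Omega> x) (map Arg Ms) \<and> list_all2 ?R Ms (tree_children \<Omega> x)"
      unfolding t(2,3) tree_con.simps tree_children.simps by blast
  qed
qed

lemma tm_eq_enc_name_iff:
  assumes "t \<in> fst ` set \<Omega>"
  shows "tm_eq \<Sigma> M (enc_name t) \<longleftrightarrow> unfolds \<Sigma> M (name_tree \<Omega> t)"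
  using unfolds_enc_name[OF assms] unfolds_functional[OF unique_names] unfolding tm_eq_def by metis

lemma tm_eq_ptyp_term_iff:
  assumes "(t, \<tau>) \<in> set \<Omega>"
  shows "tm_eq \<Sigma> (ptyp_term \<pi>) (enc_name t) \<longleftrightarrow> rel_ptyp (\<lambda>M u. tm_eq \<Sigma> M (enc_name u)) \<pi> \<tau>"
proof -
  have exposes: "exposes \<Sigma> (ptyp_term \<pi>) (ptyp_con \<pi>) (map Arg (ptyp_args \<pi>))"
    by (simp add: exposes_def ptyp_term_def)
  have "t \<in> fst ` set \<Omega>" using assms by force
  then have "tm_eq \<Sigma> (ptyp_term \<pi>) (enc_name t) \<longleftrightarrow> unfolds \<Sigma> (ptyp_term \<pi>) (name_tree \<Omega> t)"
    by (rule tm_eq_enc_name_iff)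
  also have "\<dots> \<longleftrightarrow> ptyp_con \<pi> = ptyp_con \<tau> \<and>
      list_all2 (\<lambda>M u. unfolds \<Sigma> M (name_tree \<Omega> u)) (ptyp_args \<pi>) (ptyp_args \<tau>)"
    unfolding unfolds_exposes_iff[OF unique_names exposes] tree_of_unfold[of \<Omega> "Inl t"]
    by (auto simp: definiens_eq[OF wf_osig assms] list.rel_map)
  also have "list_all2 (\<lambda>M u. unfolds \<Sigma> M (name_tree \<Omega> u)) (ptyp_args \<pi>) (ptyp_args \<tau>) \<longleftrightarrow>
      list_all2 (\<lambda>M u. tm_eq \<Sigma> M (enc_name u)) (ptyp_args \<pi>) (ptyp_args \<tau>)"
    by (intro list.rel_cong refl)
      (use ptyp_args_defined[OF wf_osig assms] tm_eq_enc_name_iff in blast)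
  finally show ?thesis unfolding rel_ptyp_iff_con_args .
qed

lemma chk_enc_name:
  assumes "t \<in> fst ` set \<Omega>"
  shows "chk \<Sigma> \<Gamma> (enc_name t) postp_ty"
proof -
  from assms obtain \<tau> where "(t, \<tau>) \<in> set \<Omega>" by auto
  from RecDecl_TName[OF this] show ?thesis
    unfolding enc_name_def chk_App_postp_iff syn_Rec_iff by (blast intro: spn_Nil)
qed

lemma wf_decl_enc_sig:
  assumes "d \<in> set (enc_sig \<Omega>)"
  shows "wf_decl \<Sigma> d"
proof -
  from assms consider (base) "d \<in> set base_sig"
    | (type_name) t \<tau> where "(t, \<tau>) \<in> set \<Omega>" "d = RecDecl (TName t) postp_ty (enc_ptyp \<tau>)"
    by (auto simp: enc_sig_def)
  then show ?thesis
  proof cases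
    case base
    then show ?thesis using wf_decl_base_sig[OF base_sig_subset] by blast
  next
    case type_name
    have "chk \<Sigma> [] (enc_name u) postp_ty" if "u \<in> set_ptyp \<tau>" for u
      using that ptyp_args_defined[OF wf_osig type_name(1)] chk_enc_name
      by (auto simp: set_ptyp_args)
    then have "chk \<Sigma> [] (enc_ptyp \<tau>) postp_ty"
      unfolding enc_ptyp_eq_ptyp_term
      by (intro chk_ptyp_term[OF base_sig_subset]) (auto simp: ptyp.set_map)
    then show ?thesis
      using wf_ty_postp[OF base_sig_subset]
      by (simp add: type_name(2)) (simp add: enc_ptyp_eq_ptyp_term ptyp_term_def)
  qed
qed

lemma chk_empty_ConI:
  assumes t: "(t, \<tau>) \<in> set \<Omega>" and rule: "emptiness_rule c \<tau> ts"
    and Ds: "list_all2 (\<lambda>D u. chk \<Sigma> [] D (empty_ty (enc_name u))) Ds ts"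
  shows "chk \<Sigma> [] (capp c (map enc_name (ptyp_args \<tau>) @ Ds)) (empty_ty (enc_name t))"
proof -
  let ?\<pi> = "map_ptyp enc_name \<tau>"
  obtain A :: "'t ety" where A: "ConDecl c A \<in> set base_sig" using ex_ConDecl_base_sig by blast
  have names: "u \<in> fst ` set \<Omega>" if "u \<in> set_ptyp \<tau>" for u
    using that ptyp_args_defined[OF wf_osig t] by (auto simp: set_ptyp_args)
  have "emptiness_rule c ?\<pi> (map enc_name ts)" using rule by (rule emptiness_rule_map)
  moreover have "list_all2 (\<lambda>D M. chk \<Sigma> [] D (empty_ty M)) Ds (map enc_name ts)"
    using Ds by (simp add: list.rel_map)
  moreover have "\<forall>M \<in> set_ptyp ?\<pi>. chk \<Sigma> [] M postp_ty"
    unfolding ptyp.set_map using names by (blast intro: chk_enc_name)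
  ultimately have "spn \<Sigma> [] (map Arg (map enc_name (ptyp_args \<tau>) @ Ds)) A (empty_ty (ptyp_term ?\<pi>))"
    unfolding spn_base_sig_empty_iff[OF A] ptyp_args_map[symmetric] by blast
  then have "syn \<Sigma> [] (capp c (map enc_name (ptyp_args \<tau>) @ Ds)) (empty_ty (ptyp_term ?\<pi>))"
    by (rule syn_Con[rotated]) (use A base_sig_subset in blast)
  moreover have "tm_eq \<Sigma> (ptyp_term ?\<pi>) (enc_name t)"
    unfolding tm_eq_ptyp_term_iff[OF t] ptyp.rel_map
    using names unfolds_enc_name tm_eq_enc_name_iff by (intro ptyp.rel_refl_strong) blast
  then have "ty_eq \<Sigma> (empty_ty (ptyp_term ?\<pi>)) (empty_ty (enc_name t))"
    by (simp add: ty_eq_Atom_iff)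
  ultimately show ?thesis by (rule chk_App)
qed

lemma chk_empty_enc_nameE:
  assumes \<Sigma>: "wf_sig \<Sigma>" and t: "(t, \<tau>) \<in> set \<Omega>" and D: "chk \<Sigma> [] D (empty_ty (enc_name t))"
  obtains c Ms Ds ts where "exposes \<Sigma> D c (map Arg (Ms @ Ds))" "emptiness_rule c \<tau> ts"
    "list_all2 (\<lambda>M u. tm_eq \<Sigma> M (enc_name u)) Ms (ptyp_args \<tau>)"
    "list_all2 (\<lambda>D u. chk \<Sigma> [] D (empty_ty (enc_name u))) Ds ts"
proof -
  from chk_Nil_AtomE[OF \<Sigma> D] obtain c S A P where
    c: "exposes \<Sigma> D c S" and A: "ConDecl c A \<in> set \<Sigma>" and spn: "spn \<Sigma> [] S A P"
    and eq: "ty_eq \<Sigma> P (empty_ty (enc_name t))" .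
  from eq obtain I where P: "P = empty_ty I" and I: "tm_eq \<Sigma> I (enc_name t)"
    by (auto simp: ty_eq_Atom_right_iff list_all2_Cons2 rel_arg_Arg_right_iff)
  from spn[unfolded P spn_base_sig_empty_iff[OF ConDecl_in_base_sig[OF A]]] obtain \<pi> Ns Ds where
    rule: "emptiness_rule c \<pi> Ns" and Ds: "list_all2 (\<lambda>D N. chk \<Sigma> [] D (empty_ty N)) Ds Ns"
    and S: "S = map Arg (ptyp_args \<pi> @ Ds)" and I_eq: "I = ptyp_term \<pi>"
    by blast
  have \<pi>: "rel_ptyp (\<lambda>M u. tm_eq \<Sigma> M (enc_name u)) \<pi> \<tau>"
    using I unfolding I_eq tm_eq_ptyp_term_iff[OF t] .
  from emptiness_rule_rel[OF rule \<pi>] obtain ts where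
    ts: "emptiness_rule c \<tau> ts" "list_all2 (\<lambda>N u. tm_eq \<Sigma> N (enc_name u)) Ns ts" .
  have "list_all2 (\<lambda>D u. chk \<Sigma> [] D (empty_ty (enc_name u))) Ds ts"
    using list_all2_trans[OF chk_empty_cong[OF unique_names] Ds ts(2)] .
  moreover have "list_all2 (\<lambda>M u. tm_eq \<Sigma> M (enc_name u)) (ptyp_args \<pi>) (ptyp_args \<tau>)"
    using \<pi> by (simp add: rel_ptyp_iff_con_args)
  ultimately show ?thesis using that c[unfolded S] ts(1) by blast
qed

end


section \<open>From canonical forms to circular derivations\<close>

definition inhabitants ::
  "'t osig \<Rightarrow> (fam, con, 't rname) lfsig \<Rightarrow> 't etm \<Rightarrow> ('t \<times> 't etm) set" where
  "inhabitants \<Omega> \<Sigma> M =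
     {(t, D). t \<in> fst ` set \<Omega> \<and> D \<in> reach \<Sigma> M \<and> chk \<Sigma> [] D (empty_ty (enc_name t))}"

lemma finite_inhabitants: "finite (inhabitants \<Omega> \<Sigma> M)"
  by (rule finite_subset[of _ "fst ` set \<Omega> \<times> reach \<Sigma> M"]) (auto simp: inhabitants_def finite_reach)

context enc_extension
begin

definition inhabitant_step ::
  "'t etm \<Rightarrow> 't \<times> 't etm \<Rightarrow> con \<Rightarrow> ('t \<times> 't etm) list \<Rightarrow> bool" where
  "inhabitant_step M s c ss \<longleftrightarrow> set ss \<subseteq> inhabitants \<Omega> \<Sigma> M \<and>
     (\<exists>\<tau> Ms. (fst s, \<tau>) \<in> set \<Omega> \<and> emptiness_rule c \<tau> (map fst ss) \<and>
        exposes \<Sigma> (snd s) c (map Arg (Ms @ map snd ss)) \<and>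
        list_all2 (\<lambda>M u. tm_eq \<Sigma> M (enc_name u)) Ms (ptyp_args \<tau>))"

lemma inhabitant_step_exists:
  assumes \<Sigma>: "wf_sig \<Sigma>" and s: "s \<in> inhabitants \<Omega> \<Sigma> M"
  shows "\<exists>c ss. inhabitant_step M s c ss"
proof -
  from s obtain t D \<tau> where s_eq: "s = (t, D)" and t: "(t, \<tau>) \<in> set \<Omega>"
    and D: "D \<in> reach \<Sigma> M" "chk \<Sigma> [] D (empty_ty (enc_name t))"
    by (auto simp: inhabitants_def)
  from chk_empty_enc_nameE[OF \<Sigma> t D(2)] obtain c Ms Ds ts where
    exposes: "exposes \<Sigma> D c (map Arg (Ms @ Ds))" and rule: "emptiness_rule c \<tau> ts"
    and Ms: "list_all2 (\<lambda>M u. tm_eq \<Sigma> M (enc_name u)) Ms (ptyp_args \<tau>)"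
    and Ds: "list_all2 (\<lambda>D u. chk \<Sigma> [] D (empty_ty (enc_name u))) Ds ts" .
  have "set ts \<subseteq> fst ` set \<Omega>"
    using emptiness_rule_premises_subset[OF rule] ptyp_args_defined[OF wf_osig t]
    by (auto simp: set_ptyp_args)
  moreover have "set Ds \<subseteq> reach \<Sigma> M" using exposes_arg_in_reach[OF exposes D(1)] by auto
  ultimately have "set (zip ts Ds) \<subseteq> inhabitants \<Omega> \<Sigma> M"
    using Ds by (auto simp: inhabitants_def list_all2_conv_all_nth set_zip subset_code(1))
  moreover have "map fst (zip ts Ds) = ts" "map snd (zip ts Ds) = Ds"
    using list_all2_lengthD[OF Ds] by simp_all
  ultimately have "inhabitant_step M s c (zip ts Ds)"
    using t rule exposes Ms by (auto simp: inhabitant_step_def s_eq)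
  then show ?thesis by blast
qed

lemma unfolds_deriv_unfold:
  assumes step: "\<And>s. s \<in> inhabitants \<Omega> \<Sigma> M \<Longrightarrow> inhabitant_step M s (rule s) (succs s)"
    and s: "s \<in> inhabitants \<Omega> \<Sigma> M"
  shows "unfolds \<Sigma> (snd s) (deriv_tree \<Omega> (deriv_unfold rule fst succs s))"
proof -
  let ?d = "deriv_unfold rule fst succs"
  let ?X = "\<lambda>D (x :: 't + 't deriv). \<exists>s \<in> inhabitants \<Omega> \<Sigma> M. D = snd s \<and> x = Inr (?d s)"
  let ?R = "\<lambda>D x. ?X D x \<or> unfolds \<Sigma> D (tree_of \<Omega> x)"
  have "?X (snd s) (Inr (?d s))" using s by blast
  then show ?thesis
  proof (rule unfolds_tree_of_coinduct)
    fix D x assume "?X D x"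
    then obtain s where s: "s \<in> inhabitants \<Omega> \<Sigma> M" "D = snd s" "x = Inr (?d s)" by blast
    from step[OF s(1)] obtain \<tau> Ms where \<tau>: "(fst s, \<tau>) \<in> set \<Omega>"
      and rule: "emptiness_rule (rule s) \<tau> (map fst (succs s))"
      and succs: "set (succs s) \<subseteq> inhabitants \<Omega> \<Sigma> M"
      and exposes: "exposes \<Sigma> D (rule s) (map Arg (Ms @ map snd (succs s)))"
      and Ms: "list_all2 (\<lambda>M u. tm_eq \<Sigma> M (enc_name u)) Ms (ptyp_args \<tau>)"
      unfolding inhabitant_step_def s(2) by blast
    note deriv = deriv_unfold_simps[where rule = rule and concl = fst and succs = succs, OF rule]
    have "list_all2 (\<lambda>M u. ?R M (Inl u)) Ms (ptyp_args \<tau>)"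
      using Ms by (rule list.rel_mono_strong)
        (use ptyp_args_defined[OF wf_osig \<tau>] tm_eq_enc_name_iff in blast)
    moreover have "list_all2 ?R (map snd (succs s)) (map (Inr \<circ> ?d) (succs s))"
      unfolding list.rel_map by (rule list.rel_refl_strong) (use succs in auto)
    ultimately have "list_all2 ?R (Ms @ map snd (succs s)) (tree_children \<Omega> x)"
      unfolding s(3) by (simp add: deriv definiens_eq[OF wf_osig \<tau>] list.rel_map list_all2_appendI)
    with exposes show "\<exists>Ds. exposes \<Sigma> D (tree_con \<Omega> x) (map Arg Ds) \<and>
        list_all2 ?R Ds (tree_children \<Omega> x)"
      unfolding s(3) tree_con.simps deriv(2) by blast
  qed
qed

lemma inhabitant_unfolds_to_deriv_tree:
  assumes \<Sigma>: "wf_sig \<Sigma>" and t: "t \<in> fst ` set \<Omega>" and M: "chk \<Sigma> [] M (empty_ty (enc_name t))"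
  shows "\<exists>d \<in> circular_derivations \<Omega> t. unfolds \<Sigma> M (deriv_tree \<Omega> d)"
proof -
  have "\<exists>rule. \<forall>s \<in> inhabitants \<Omega> \<Sigma> M. \<exists>ss. inhabitant_step M s (rule s) ss"
    using inhabitant_step_exists[OF \<Sigma>] by (intro bchoice) blast
  then obtain rule where "\<forall>s \<in> inhabitants \<Omega> \<Sigma> M. \<exists>ss. inhabitant_step M s (rule s) ss" by blast
  from bchoice[OF this] obtain succs where
    step: "\<And>s. s \<in> inhabitants \<Omega> \<Sigma> M \<Longrightarrow> inhabitant_step M s (rule s) (succs s)" by blast
  have root: "(t, M) \<in> inhabitants \<Omega> \<Sigma> M"
    using t M self_in_subtms by (auto simp: inhabitants_def reach_def)
  let ?d = "deriv_unfold rule fst succs (t, M)"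
  have "?d \<in> circular_derivations \<Omega> (fst (t, M))"
    by (rule circular_derivation_deriv_unfold[OF finite_inhabitants root])
      (use step in \<open>unfold inhabitant_step_def, blast\<close>)+
  moreover have "unfolds \<Sigma> M (deriv_tree \<Omega> ?d)"
    using unfolds_deriv_unfold[OF step root] by simp
  ultimately show ?thesis by auto
qed

end

lemma canonical_form_in_deriv_tree_image:
  assumes \<Omega>: "wf_osig \<Omega>" and t: "t \<in> fst ` set \<Omega>"
    and T: "T \<in> canonical_forms (enc_sig \<Omega>) (empty_ty (enc_name t))"
  shows "T \<in> deriv_tree \<Omega> ` circular_derivations \<Omega> t"
proof -
  from T obtain \<Delta> M where \<Sigma>: "wf_sig (enc_sig \<Omega> @ \<Delta>)"
    and M: "chk (enc_sig \<Omega> @ \<Delta>) [] M (empty_ty (enc_name t))" "unfolds (enc_sig \<Omega> @ \<Delta>) M T"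
    by (auto simp: canonical_forms_def)
  interpret enc_extension \<Omega> "enc_sig \<Omega> @ \<Delta>"
    using \<Omega> inj_decl_name_if_wf_sig[OF \<Sigma>] by unfold_locales auto
  from inhabitant_unfolds_to_deriv_tree[OF \<Sigma> t M(1)] obtain d where
    "d \<in> circular_derivations \<Omega> t" "unfolds (enc_sig \<Omega> @ \<Delta>) M (deriv_tree \<Omega> d)" by blast
  with unfolds_functional[OF unique_names M(2)] show ?thesis by blast
qed


section \<open>From circular derivations to canonical forms\<close>

locale numbered_derivations =
  fixes \<Omega> :: "'t osig" and ds :: "'t deriv list" and number :: "'t deriv \<Rightarrow> nat"
  assumes wf_osig: "wf_osig \<Omega>"
    and derives: "d \<in> set ds \<Longrightarrow> derives \<Omega> d (conclusion d)"
    and direct_subderivs_closed: "d \<in> set ds \<Longrightarrow> set (direct_subderivs d) \<subseteq> set ds"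
    and distinct_numbers: "distinct (map number ds)"
begin

definition aux_const :: "'t deriv \<Rightarrow> 't etm" where
  "aux_const d = App (Rec (Aux (number d))) []"

definition aux_body :: "'t deriv \<Rightarrow> 't etm" where
  "aux_body d = capp (last_rule d)
     (map enc_name (ptyp_args (definiens \<Omega> (conclusion d))) @ map aux_const (direct_subderivs d))"

definition aux_sig :: "(fam, con, 't rname) lfsig" where
  "aux_sig =
     map (\<lambda>d. RecDecl (Aux (number d)) (empty_ty (enc_name (conclusion d))) (aux_body d)) ds"

abbreviation ext_sig :: "(fam, con, 't rname) lfsig" where
  "ext_sig \<equiv> enc_sig \<Omega> @ aux_sig"

lemma distinct_ext_sig: "distinct (map decl_name ext_sig)"
proof -
  have "map decl_name aux_sig = map (RecName \<circ> Aux) (map number ds)"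
    by (simp add: aux_sig_def)
  moreover have "distinct \<dots>"
    using distinct_numbers by (simp only: distinct_map[of _ "map number ds"]) (simp add: inj_on_def)
  ultimately have "distinct (map decl_name aux_sig)" by (simp only:)
  moreover have "decl_name ` set (enc_sig \<Omega>) \<inter> decl_name ` set aux_sig = {}"
    by (auto simp: enc_sig_def base_sig_def aux_sig_def)
  ultimately show ?thesis using distinct_enc_sig[OF wf_osig] by simp
qed

sublocale enc_extension \<Omega> ext_sig
proof
  show "wf_osig \<Omega>" by (rule wf_osig)
  show "set (enc_sig \<Omega>) \<subseteq> set ext_sig" by simp
  show "inj_on decl_name (set ext_sig)" using distinct_ext_sig unfolding distinct_map ..
qed

lemma conclusion_defined: "d \<in> set ds \<Longrightarrow> conclusion d \<in> fst ` set \<Omega>"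
  by (rule derives_root[OF derives]) force+

lemma RecDecl_Aux:
  "d \<in> set ds \<Longrightarrow>
    RecDecl (Aux (number d)) (empty_ty (enc_name (conclusion d))) (aux_body d) \<in> set ext_sig"
  by (simp add: aux_sig_def)

lemma chk_aux_const:
  assumes "d \<in> set ds"
  shows "chk ext_sig [] (aux_const d) (empty_ty (enc_name (conclusion d)))"
proof -
  let ?A = "empty_ty (enc_name (conclusion d))"
  have "syn ext_sig [] (aux_const d) ?A"
    unfolding aux_const_def using RecDecl_Aux[OF assms] spn_Nil by (rule syn_Rec)
  moreover have "ty_eq ext_sig ?A ?A"
    using unfolds_enc_name[OF conclusion_defined[OF assms]] by (auto simp: ty_eq_Atom_iff tm_eq_def)
  ultimately show ?thesis unfolding aux_const_def by (rule chk_App)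
qed

lemma chk_aux_body:
  assumes "d \<in> set ds"
  shows "chk ext_sig [] (aux_body d) (empty_ty (enc_name (conclusion d)))"
proof -
  from derives_root[OF derives[OF assms]] obtain \<tau> where \<tau>: "(conclusion d, \<tau>) \<in> set \<Omega>"
    and rule: "emptiness_rule (last_rule d) \<tau> (map conclusion (direct_subderivs d))"
    by blast
  have "list_all2 (\<lambda>D u. chk ext_sig [] D (empty_ty (enc_name u)))
      (map aux_const (direct_subderivs d)) (map conclusion (direct_subderivs d))"
    unfolding list.rel_map
    by (rule list.rel_refl_strong) (use direct_subderivs_closed[OF assms] chk_aux_const in blast)
  from chk_empty_ConI[OF \<tau> rule this] show ?thesis
    by (simp only: aux_body_def definiens_eq[OF wf_osig \<tau>])
qed

lemma wf_ext_sig: "wf_sig ext_sig"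
  unfolding wf_sig_def
proof (intro conjI ballI distinct_ext_sig)
  fix e assume "e \<in> set ext_sig"
  then consider (enc) "e \<in> set (enc_sig \<Omega>)"
    | (aux) d where "d \<in> set ds"
      "e = RecDecl (Aux (number d)) (empty_ty (enc_name (conclusion d))) (aux_body d)"
    by (auto simp: aux_sig_def)
  then show "wf_decl ext_sig e"
  proof cases
    case enc
    then show ?thesis by (rule wf_decl_enc_sig)
  next
    case aux
    have "wf_ty ext_sig [] (empty_ty (enc_name (conclusion d)))"
      using wf_ty_empty[OF base_sig_subset chk_enc_name[OF conclusion_defined[OF aux(1)]]] .
    with chk_aux_body[OF aux(1)] show ?thesis by (simp add: aux(2)) (simp add: aux_body_def)
  qed
qed

lemma unfolds_aux_const:
  assumes "d \<in> set ds"
  shows "unfolds ext_sig (aux_const d) (deriv_tree \<Omega> d)"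
proof (rule unfolds_tree_of_coinduct[where X = "\<lambda>D x. \<exists>d \<in> set ds. D = aux_const d \<and> x = Inr d"])
  let ?R = "\<lambda>D x. (\<exists>d \<in> set ds. D = aux_const d \<and> x = Inr d) \<or> unfolds ext_sig D (tree_of \<Omega> x)"
  fix D and x :: "'t + 't deriv"
  assume "\<exists>d \<in> set ds. D = aux_const d \<and> x = Inr d"
  then obtain d where d: "d \<in> set ds" "D = aux_const d" "x = Inr d" by blast
  let ?us = "ptyp_args (definiens \<Omega> (conclusion d))"
  from conclusion_defined[OF d(1)] obtain \<tau> where \<tau>: "(conclusion d, \<tau>) \<in> set \<Omega>" by auto
  have "list_all2 ?R (map enc_name ?us) (map Inl ?us)"
    unfolding list.rel_map definiens_eq[OF wf_osig \<tau>]
    by (rule list.rel_refl_strong) (use ptyp_args_defined[OF wf_osig \<tau>] unfolds_enc_name in blast)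
  moreover have "list_all2 ?R (map aux_const (direct_subderivs d)) (map Inr (direct_subderivs d))"
    unfolding list.rel_map
    by (rule list.rel_refl_strong) (use direct_subderivs_closed[OF d(1)] in blast)
  moreover have "exposes ext_sig D (last_rule d)
      (map Arg (map enc_name ?us @ map aux_const (direct_subderivs d)))"
    unfolding exposes_def d(2) aux_const_def[of d] using RecDecl_Aux[OF d(1), unfolded aux_body_def]
    by blast
  ultimately show "\<exists>Ds. exposes ext_sig D (tree_con \<Omega> x) (map Arg Ds) \<and>
      list_all2 ?R Ds (tree_children \<Omega> x)"
    unfolding d(3) tree_con.simps tree_children.simps by (blast intro: list_all2_appendI)
qed (use assms in blast)

lemma deriv_tree_canonical:
  assumes "d \<in> set ds"
  shows "deriv_tree \<Omega> d \<in> canonical_forms (enc_sig \<Omega>) (empty_ty (enc_name (conclusion d)))"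
proof -
  have "\<forall>e \<in> set aux_sig. is_RecDecl e" by (simp add: aux_sig_def)
  with wf_ext_sig chk_aux_const[OF assms] unfolds_aux_const[OF assms] show ?thesis
    unfolding canonical_forms_def by blast
qed

end

lemma deriv_tree_in_canonical_forms:
  assumes \<Omega>: "wf_osig \<Omega>" and d: "d \<in> circular_derivations \<Omega> t"
  shows "deriv_tree \<Omega> d \<in> canonical_forms (enc_sig \<Omega>) (empty_ty (enc_name t))"
proof -
  from d have der: "derives \<Omega> d t" and fin: "finite (subderivs d)"
    by (auto simp: circular_derivations_def)
  from fin obtain ds where ds: "set ds = subderivs d" "distinct ds"
    using finite_distinct_list by blast
  from fin obtain number :: "'a deriv \<Rightarrow> nat" where "inj_on number (subderivs d)"
    using finite_imp_inj_to_nat_seg by blast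
  then interpret numbered_derivations \<Omega> ds number
    using \<Omega> ds derives_subderiv[OF _ der] direct_subderivs_in_subderivs
    by unfold_locales (auto simp: distinct_map)
  show ?thesis
    using deriv_tree_canonical[of d] ds(1) derives_conclusion[OF der] subderivs.intros(1) by metis
qed

theorem theorem8:
  fixes \<Omega> :: "'t osig" and t :: 't
  assumes "wf_osig \<Omega>"
    and "t \<in> fst ` set \<Omega>"
  shows "\<exists>f. bij_betw f (circular_derivations \<Omega> t)
               (canonical_forms (enc_sig \<Omega>) (empty_ty (enc_name t)))"
proof -
  let ?D = "circular_derivations \<Omega> t" and ?C = "canonical_forms (enc_sig \<Omega>) (empty_ty (enc_name t))"
  have "inj_on (deriv_tree \<Omega>) ?D"
    by (rule inj_on_subset[OF inj_on_deriv_tree[OF assms(1)]]) (auto simp: circular_derivations_def)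
  moreover have "deriv_tree \<Omega> ` ?D \<subseteq> ?C"
    using deriv_tree_in_canonical_forms[OF assms(1)] by blast
  moreover have "?C \<subseteq> deriv_tree \<Omega> ` ?D"
    using canonical_form_in_deriv_tree_image[OF assms] by blast
  ultimately have "bij_betw (deriv_tree \<Omega>) ?D ?C" by (simp add: bij_betw_def subset_antisym)
  then show ?thesis by blast
qed

end
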